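(* Let $p$ be a prime and let $G$ be a profinite group such that the commutator subgroup $G'$ is a pro-$p$ group. Let $C_1,C_2,\dots$ be countably many procyclic subgroups of $G'$ whose union contains the set of all commutators $\{[x,y]\mid x,y\in G\}$. Then at least one of the subgroups $C_k$ is open in $G'$.
   Context: For elements $x,y$ of a group, $[x,y]=x^{-1}y^{-1}xy$. For a profinite group $G$, the commutator subgroup $G'$ is the closed subgroup of $G$ (topologically) generated by all commutators. A profinite group is procyclic if it is topologically generated by one element; procyclic subgroups are closed subgroups. "Countably many" means finitely or countably infinitely many. *)

theory Defs
  imports
    "HOL-Analysis.Analysis"
    "HOL-Algebra.Generated_Groups"
    "HOL-Computational_Algebra.Primes"
begin

locale topological_group = group G for G (structure) +
  fixes T :: "'a topology"
  assumes topspace_eq_carrier: "topspace T = carrier G"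
    and continuous_mult: "continuous_map (prod_topology T T) T (\<lambda>(x, y). x \<otimes> y)"
    and continuous_inv: "continuous_map T T (\<lambda>x. inv x)"

definition totally_disconnected_space :: "'a topology \<Rightarrow> bool" where
  "totally_disconnected_space X \<longleftrightarrow> (\<forall>K\<in>connected_components_of X. \<exists>x. K = {x})"

locale profinite_group = topological_group +
  assumes compact: "compact_space T"
    and Hausdorff: "Hausdorff_space T"
    and totally_disconnected: "totally_disconnected_space T"

text \<open>In a compact group an open subgroup has finitely many cosets, so \<^term>\<open>card\<close> below is the
  genuine index. For infinitely many cosets it would be 0, which is not a power of a prime.\<close>

locale pro_p_group = profinite_group +
  fixes p :: nat
  assumes prime_p: "prime p"
    and open_normal_index:
      "\<And>N. \<lbrakk>N \<lhd> G; openin T N\<rbrakk> \<Longrightarrow> \<exists>n. card (rcosets N) = p ^ n"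

definition topologically_generated :: "('a, 'b) monoid_scheme \<Rightarrow> 'a topology \<Rightarrow> 'a set \<Rightarrow> 'a set" where
  "topologically_generated G T S = T closure_of (generate G S)"

text \<open>The convention for commutators is \<open>[x, y] = x\<inverse> y\<inverse> x y\<close>, which differs from the one used by
  the derived subgroup \<^const>\<open>derived\<close> of HOL-Algebra.\<close>

definition commutator :: "('a, 'b) monoid_scheme \<Rightarrow> 'a \<Rightarrow> 'a \<Rightarrow> 'a" where
  "commutator G x y = inv\<^bsub>G\<^esub> x \<otimes>\<^bsub>G\<^esub> inv\<^bsub>G\<^esub> y \<otimes>\<^bsub>G\<^esub> x \<otimes>\<^bsub>G\<^esub> y"

definition commutators :: "('a, 'b) monoid_scheme \<Rightarrow> 'a set" where
  "commutators G = {commutator G x y | x y. x \<in> carrier G \<and> y \<in> carrier G}"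

definition commutator_subgroup :: "('a, 'b) monoid_scheme \<Rightarrow> 'a topology \<Rightarrow> 'a set" where
  "commutator_subgroup G T = topologically_generated G T (commutators G)"

definition procyclic_group :: "('a, 'b) monoid_scheme \<Rightarrow> 'a topology \<Rightarrow> bool" where
  "procyclic_group G T \<longleftrightarrow>
     profinite_group G T \<and> (\<exists>g\<in>carrier G. topologically_generated G T {g} = carrier G)"

definition procyclic_subgroup :: "'a set \<Rightarrow> ('a, 'b) monoid_scheme \<Rightarrow> 'a topology \<Rightarrow> bool" where
  "procyclic_subgroup C G T \<longleftrightarrow>
     subgroup C G \<and> closedin T C \<and> procyclic_group (G\<lparr>carrier := C\<rparr>) (subtopology T C)"

end

theory Submission
  imports Defs "HOL-Algebra.Multiplicative_Group"
begin

text \<open>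
  Write \<open>x\<^sup>y = y\<inverse> x y\<close>. The proof finds a member \<open>C\<close> of the cover and an open normal subgroup
  \<open>N\<close> of \<open>G\<close> such that \<open>[g, n] \<in> C\<close> for all \<open>g \<in> G\<close> and \<open>n \<in> N\<close> (\<open>uniform_germ_exists\<close>). This
  suffices: the elements \<open>[g, n]\<close> generate a normal subgroup \<open>E\<close> of \<open>G\<close> inside \<open>C\<close>, and \<open>G / E\<close> has
  a central subgroup of finite index, so by Schur's theorem the commutators of \<open>G\<close> generate a
  subgroup that is finite modulo \<open>E\<close>. It is therefore contained in finitely many cosets of the
  closed subgroup \<open>C\<close>, and so is its closure \<open>G'\<close>. Hence \<open>C\<close> has finite index in \<open>G'\<close> and is open.

  The cover enters through Baire's theorem on \<open>G \<times> G\<close>: any two given open cosets contain \<open>a\<close> and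
  \<open>b\<close>, respectively, for which there is an open normal \<open>N\<close> such that \<open>[a N, b N]\<close> lies in a single \<open>C\<close>. Then \<open>C\<close> contains
  \<open>[a\<^sup>b, N]\<close>, \<open>[b\<^sup>a, N]\<close> and \<open>[N, N]\<close>. So locally, at \<open>\<one>\<close>, each map \<open>n \<mapsto> [x, n]\<close> takes its values in
  some member of the cover, up to a change of \<open>x\<close> inside a coset, and it remains to see that the same
  member can be used for all \<open>x\<close>. The pro-\<open>p\<close> hypothesis gives the tool for that: a nontrivial
  closed subgroup of a procyclic pro-\<open>p\<close> group is open in it (\<open>procyclic_pro_p_uniserial\<close>), so two
  members of the cover that intersect nontrivially agree near \<open>\<one>\<close>.

  If no open normal subgroup is abelian, then every member in question shares a nontrivial commutator
  \<open>[n, m]\<close> with a fixed one, and hence agrees with it near \<open>\<one>\<close>. If \<open>A\<close> is an open normal abelian subgroup, the map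
  \<open>n \<mapsto> [x, n]\<close> on \<open>A\<close> depends only on the coset of \<open>x\<close>. Call \<open>x\<close> bad if this map is not trivial
  near \<open>\<one>\<close>, and write \<open>x \<approx> y\<close> if the same closed subgroups contain its germ for \<open>x\<close> and for \<open>y\<close>.
  Baire's theorem gives \<open>x\<^sup>y \<approx> y\<^sup>x\<close> for bad \<open>x\<close> and \<open>y\<close>. Applying this also to products of \<open>x\<close> and
  \<open>y\<close> shows that all bad elements are equivalent (\<open>uniform_germ_abelian\<close>).
\<close>

section \<open>Commutators and Schur's theorem\<close>

context group
begin

abbreviation conj_by :: "'a \<Rightarrow> 'a \<Rightarrow> 'a" where
  "conj_by x y \<equiv> inv y \<otimes> x \<otimes> y"

lemma cancel_left [simp]:
  assumes "x \<in> carrier G" "y \<in> carrier G"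
  shows "x \<otimes> (inv x \<otimes> y) = y" and "inv x \<otimes> (x \<otimes> y) = y"
  using assms by (simp_all flip: m_assoc)

lemmas word_simps = m_assoc inv_mult_group

lemma commutator_closed [simp]:
  "x \<in> carrier G \<Longrightarrow> y \<in> carrier G \<Longrightarrow> commutator G x y \<in> carrier G"
  by (simp add: commutator_def)

lemma commutators_subset: "commutators G \<subseteq> carrier G"
  by (auto simp: commutators_def)

lemma inv_commutator:
  "x \<in> carrier G \<Longrightarrow> y \<in> carrier G \<Longrightarrow> inv (commutator G x y) = commutator G y x"
  by (simp add: commutator_def word_simps)

lemma conj_commutator:
  "\<lbrakk>x \<in> carrier G; y \<in> carrier G; g \<in> carrier G\<rbrakk> \<Longrightarrow>
    conj_by (commutator G x y) g = commutator G (conj_by x g) (conj_by y g)"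
  by (simp add: commutator_def word_simps)

lemma commutator_mult_left:
  "\<lbrakk>x \<in> carrier G; y \<in> carrier G; n \<in> carrier G\<rbrakk> \<Longrightarrow>
    commutator G (x \<otimes> y) n = conj_by (commutator G x n) y \<otimes> commutator G y n"
  by (simp add: commutator_def word_simps)

lemma commutator_central_left:
  assumes "x \<in> carrier G" "y \<in> carrier G" "z \<in> carrier G"
    and central: "\<And>g. g \<in> carrier G \<Longrightarrow> z \<otimes> g = g \<otimes> z"
  shows "commutator G (z \<otimes> x) y = commutator G x y"
proof -
  have "inv y \<otimes> (z \<otimes> (x \<otimes> y)) = z \<otimes> (inv y \<otimes> (x \<otimes> y))"
    using assms(1-3) central[of "inv y"] by (metis inv_closed m_assoc m_closed)
  then show ?thesis
    using assms(1-3) by (simp add: commutator_def word_simps)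
qed

lemma commutator_central_right:
  assumes "x \<in> carrier G" "y \<in> carrier G" "z \<in> carrier G"
    and "\<And>g. g \<in> carrier G \<Longrightarrow> z \<otimes> g = g \<otimes> z"
  shows "commutator G x (z \<otimes> y) = commutator G x y"
  using commutator_central_left[of y x z] assms
  by (metis inv_commutator m_closed)

text \<open>This is the step that makes Schur's theorem work: once \<open>[x, y]\<^sup>n\<close> is central, it can be moved
  next to \<open>y\<close> inside one further factor \<open>[x, y]\<close>, which saves one commutator.\<close>

lemma commutator_pow_Suc:
  assumes x: "x \<in> carrier G" and y: "y \<in> carrier G" and n: "n > 0"
    and central: "\<And>g. g \<in> carrier G \<Longrightarrow> commutator G x y [^] n \<otimes> g = g \<otimes> commutator G x y [^] n"
  shows "commutator G x y [^] Suc n = commutator G x (y \<otimes> y) \<otimes> commutator G (conj_by x y) y [^] (n - 1)"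
proof -
  define c where "c = commutator G x y"
  have c: "c \<in> carrier G" using x y by (simp add: c_def)
  obtain m where m: "n = Suc m" using n by (cases n) auto
  have conj_pow: "inv y \<otimes> (c [^] m \<otimes> y) = commutator G (conj_by x y) y [^] m" for m :: nat
  proof (induction m)
    case (Suc m)
    have "commutator G (conj_by x y) y = inv y \<otimes> c \<otimes> y"
      using x y by (simp add: c_def commutator_def word_simps)
    moreover have "inv y \<otimes> (c [^] Suc m \<otimes> y) = (inv y \<otimes> (c [^] m \<otimes> y)) \<otimes> (inv y \<otimes> c \<otimes> y)"
      using c y by (simp add: word_simps)
    ultimately show ?case using Suc by simp
  qed (use y in simp)
  have "c [^] Suc n = c \<otimes> c [^] n"
    using c by (simp only: nat_pow_Suc2)
  also have "\<dots> = inv x \<otimes> inv y \<otimes> x \<otimes> (y \<otimes> c [^] n)"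
    using x y c by (simp add: c_def commutator_def word_simps)
  also have "y \<otimes> c [^] n = c [^] n \<otimes> y"
    using central[OF y] by (simp add: c_def)
  also have "c [^] n = c \<otimes> c [^] m"
    using c by (simp only: m nat_pow_Suc2)
  also have "inv x \<otimes> inv y \<otimes> x \<otimes> (c \<otimes> c [^] m \<otimes> y)
      = (inv x \<otimes> inv y \<otimes> x \<otimes> c \<otimes> y) \<otimes> (inv y \<otimes> (c [^] m \<otimes> y))"
    using x y c by (simp add: word_simps)
  also have "inv x \<otimes> inv y \<otimes> x \<otimes> c \<otimes> y = commutator G x (y \<otimes> y)"
    using x y by (simp add: c_def commutator_def word_simps)
  finally show ?thesis unfolding conj_pow by (simp only: m c_def diff_Suc_1)
qed

definition list_prod :: "'a list \<Rightarrow> 'a" where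
  "list_prod ws = foldr (\<otimes>) ws \<one>"

lemma list_prod_simps [simp]:
  "list_prod [] = \<one>" "list_prod (w # ws) = w \<otimes> list_prod ws"
  by (simp_all add: list_prod_def)

lemma list_prod_closed [simp]: "set ws \<subseteq> carrier G \<Longrightarrow> list_prod ws \<in> carrier G"
  by (induction ws) auto

lemma list_prod_append [simp]:
  "set us \<subseteq> carrier G \<Longrightarrow> set vs \<subseteq> carrier G \<Longrightarrow> list_prod (us @ vs) = list_prod us \<otimes> list_prod vs"
  by (induction us) (auto simp: m_assoc)

lemma list_prod_replicate: "c \<in> carrier G \<Longrightarrow> list_prod (replicate n c) = c [^] n"
  by (induction n) (simp_all only: replicate.simps list_prod_simps nat_pow_0 nat_pow_Suc2)

text \<open>Inside a set that is closed under conjugation, repeated occurrences of a factor can be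
  collected at the front of a product without changing its length.\<close>

lemma collect_factor:
  assumes S: "S \<subseteq> carrier G" and conj: "\<And>s g. s \<in> S \<Longrightarrow> g \<in> carrier G \<Longrightarrow> conj_by s g \<in> S"
    and "c \<in> S" "set ws \<subseteq> S" "m \<le> count_list ws c"
  shows "\<exists>vs. set vs \<subseteq> S \<and> length vs + m = length ws \<and> list_prod ws = c [^] m \<otimes> list_prod vs"
  using assms(4,5)
proof (induction ws arbitrary: m)
  case Nil
  then show ?case by simp
next
  case (Cons w ws)
  have c: "c \<in> carrier G" and w: "w \<in> carrier G" and ws: "set ws \<subseteq> S"
    using S \<open>c \<in> S\<close> Cons.prems by auto
  consider "m = 0" | k where "m = Suc k" "w = c" "k \<le> count_list ws c"
    | "w \<noteq> c" "m \<le> count_list ws c"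
    using Cons.prems by (cases m) (auto split: if_splits)
  then show ?case
  proof cases
    case 1
    then show ?thesis
      using Cons.prems S by (intro exI[of _ "w # ws"]) (auto simp: subset_iff)
  next
    case 2
    then obtain vs where vs: "set vs \<subseteq> S" "length vs + k = length ws"
      "list_prod ws = c [^] k \<otimes> list_prod vs"
      using Cons.IH ws by blast
    have "list_prod (w # ws) = c [^] m \<otimes> list_prod vs"
      unfolding list_prod_simps 2 nat_pow_Suc2[OF c] vs(3) using c vs(1) S
      by (subst m_assoc) auto
    with vs 2 show ?thesis by (intro exI[of _ vs]) auto
  next
    case 3
    then obtain vs where vs: "set vs \<subseteq> S" "length vs + m = length ws"
      "list_prod ws = c [^] m \<otimes> list_prod vs"
      using Cons.IH ws by blast
    have cl: "list_prod vs \<in> carrier G" using vs S by auto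
    have "list_prod (w # ws) = c [^] m \<otimes> list_prod (conj_by w (c [^] m) # vs)"
      using w c cl vs(3) by (simp add: word_simps)
    moreover have "conj_by w (c [^] m) \<in> S"
      using conj Cons.prems c by simp
    ultimately show ?thesis
      using vs by (intro exI[of _ "conj_by w (c [^] m) # vs"]) auto
  qed
qed

lemma generate_eq_list_prods:
  assumes S: "S \<subseteq> carrier G" and inv: "\<And>s. s \<in> S \<Longrightarrow> inv s \<in> S"
    and "x \<in> generate G S"
  shows "\<exists>ws. set ws \<subseteq> S \<and> x = list_prod ws"
  using assms(3)
proof induction
  case one
  show ?case by (rule exI[of _ "[]"]) simp
next
  case (incl h)
  then show ?case using S by (intro exI[of _ "[h]"]) auto
next
  case (inv h)
  then show ?case using S assms(2) by (intro exI[of _ "[inv h]"]) auto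
next
  case (eng h1 h2)
  then obtain us vs where "set us \<subseteq> S" "h1 = list_prod us" "set vs \<subseteq> S" "h2 = list_prod vs"
    by blast
  then show ?case using S by (intro exI[of _ "us @ vs"]) auto
qed

text \<open>Schur's theorem. In a shortest product of commutators no factor occurs more than \<open>n\<close> times,
  since \<open>n + 1\<close> equal factors could be replaced by \<open>n\<close> commutators.\<close>

theorem schur_finite_generate_commutators:
  assumes fin: "finite (commutators G)" and n: "n > 0"
    and central: "\<And>x g. x \<in> carrier G \<Longrightarrow> g \<in> carrier G \<Longrightarrow> x [^] (n::nat) \<otimes> g = g \<otimes> x [^] n"
  shows "finite (generate G (commutators G))"
proof -
  let ?S = "commutators G"
  have S: "?S \<subseteq> carrier G" by (rule commutators_subset)
  have inv: "inv s \<in> ?S" if "s \<in> ?S" for s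
    using that inv_commutator by (auto simp: commutators_def)
  have conj: "conj_by s g \<in> ?S" if "s \<in> ?S" "g \<in> carrier G" for s g
    using that conj_commutator by (fastforce simp: commutators_def)
  have "x \<in> list_prod ` {ws. set ws \<subseteq> ?S \<and> length ws \<le> n * card ?S}"
    if x: "x \<in> generate G ?S" for x
  proof -
    define P where "P = (\<lambda>ws. set ws \<subseteq> ?S \<and> x = list_prod ws)"
    define ws where "ws = arg_min length P"
    have ex: "\<exists>ws. P ws"
      using generate_eq_list_prods[OF S inv x] by (auto simp: P_def)
    then have ws: "set ws \<subseteq> ?S" "x = list_prod ws"
      using arg_min_natI[of P] unfolding ws_def P_def by metis+
    have minimal: "length ws \<le> length vs" if "set vs \<subseteq> ?S" "x = list_prod vs" for vs
      using arg_min_nat_le[of P vs length] that by (simp add: ws_def P_def)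
    have "count_list ws c \<le> n" if c: "c \<in> ?S" for c
    proof (rule ccontr)
      assume "\<not> count_list ws c \<le> n"
      then obtain vs where vs: "set vs \<subseteq> ?S" "length vs + Suc n = length ws"
        "x = c [^] Suc n \<otimes> list_prod vs"
        using collect_factor[OF S conj c ws(1), of "Suc n"] ws(2) by auto
      obtain a b where ab: "a \<in> carrier G" "b \<in> carrier G" "c = commutator G a b"
        using c by (auto simp: commutators_def)
      define d e where "d = commutator G a (b \<otimes> b)" and "e = commutator G (conj_by a b) b"
      have de: "d \<in> ?S" "e \<in> ?S"
        using ab unfolding commutators_def d_def e_def by blast+
      have "c [^] Suc n = d \<otimes> e [^] (n - 1)"
        unfolding d_def e_def ab(3) using commutator_pow_Suc[OF ab(1,2) n] central ab by simp
      then have "x = list_prod (d # replicate (n - 1) e @ vs)"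
        using vs de S by (subst vs(3)) (auto simp: list_prod_replicate m_assoc subset_iff)
      moreover have "set (d # replicate (n - 1) e @ vs) \<subseteq> ?S"
        using de vs by auto
      ultimately have "length ws \<le> length (d # replicate (n - 1) e @ vs)"
        using minimal by blast
      with vs(2) n show False by simp
    qed
    moreover have "length ws = (\<Sum>c\<in>?S. count_list ws c)"
      using sum_count_set[OF ws(1) fin] by simp
    ultimately have "length ws \<le> n * card ?S"
      using sum_bounded_above[of ?S "count_list ws" n] by (simp add: mult.commute)
    with ws show ?thesis by blast
  qed
  then have "generate G ?S \<subseteq> list_prod ` {ws. set ws \<subseteq> ?S \<and> length ws \<le> n * card ?S}"
    by blast
  then show ?thesis
    using finite_lists_length_le[OF fin] finite_surj by blast
qed

end

section \<open>Open normal subgroups of profinite groups\<close>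

context topological_group
begin

lemma continuous_map_mult [continuous_intros]:
  assumes "continuous_map X T f" "continuous_map X T g"
  shows "continuous_map X T (\<lambda>x. f x \<otimes> g x)"
  using continuous_map_compose[OF continuous_map_pairedI[OF assms] continuous_mult]
  by (simp add: o_def)

lemma continuous_map_inverse [continuous_intros]:
  assumes "continuous_map X T f"
  shows "continuous_map X T (\<lambda>x. inv (f x))"
  using continuous_map_compose[OF assms continuous_inv] by (simp add: o_def)

lemma continuous_map_commutator [continuous_intros]:
  assumes "continuous_map X T f" "continuous_map X T g"
  shows "continuous_map X T (\<lambda>x. commutator G (f x) (g x))"
  unfolding commutator_def by (intro continuous_map_mult continuous_map_inverse assms)

lemma openin_carrier: "openin T U \<Longrightarrow> U \<subseteq> carrier G"
  using openin_subset[of T U] by (simp add: topspace_eq_carrier)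

lemma closedin_carrier: "closedin T U \<Longrightarrow> U \<subseteq> carrier G"
  using closedin_subset[of T U] by (simp add: topspace_eq_carrier)

lemma rcoset_eq_preimage:
  assumes "U \<subseteq> carrier G" "a \<in> carrier G"
  shows "U #> a = {x \<in> topspace T. x \<otimes> inv a \<in> U}"
proof
  show "U #> a \<subseteq> {x \<in> topspace T. x \<otimes> inv a \<in> U}"
    using assms by (auto simp: r_coset_def topspace_eq_carrier m_assoc subset_iff)
next
  have "x = (x \<otimes> inv a) \<otimes> a" if "x \<in> carrier G" for x
    using that assms by (simp add: m_assoc)
  then show "{x \<in> topspace T. x \<otimes> inv a \<in> U} \<subseteq> U #> a"
    unfolding r_coset_def topspace_eq_carrier by blast
qed

lemma openin_rcoset:
  assumes "openin T U" "a \<in> carrier G"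
  shows "openin T (U #> a)"
proof -
  have "continuous_map T T (\<lambda>x. x \<otimes> inv a)"
    using assms(2) by (intro continuous_intros) (simp add: topspace_eq_carrier)
  from openin_continuous_map_preimage[OF this assms(1)] show ?thesis
    using rcoset_eq_preimage[OF openin_carrier[OF assms(1)] assms(2)] by simp
qed

lemma closedin_rcoset:
  assumes "closedin T U" "a \<in> carrier G"
  shows "closedin T (U #> a)"
proof -
  have "continuous_map T T (\<lambda>x. x \<otimes> inv a)"
    using assms(2) by (intro continuous_intros) (simp add: topspace_eq_carrier)
  from closedin_continuous_map_preimage[OF this assms(1)] show ?thesis
    using rcoset_eq_preimage[OF closedin_carrier[OF assms(1)] assms(2)] by simp
qed

definition open_normal :: "'a set \<Rightarrow> bool" where
  "open_normal N \<longleftrightarrow> N \<lhd> G \<and> openin T N"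

lemma open_normal_subgroup: "open_normal N \<Longrightarrow> subgroup N G"
  by (simp add: open_normal_def normal_imp_subgroup)

lemma open_normal_carrier [simp]: "open_normal (carrier G)"
  unfolding open_normal_def normal_inv_iff
  using openin_topspace[of T] subgroup_self by (simp add: topspace_eq_carrier)

lemma open_normal_Int: "open_normal M \<Longrightarrow> open_normal N \<Longrightarrow> open_normal (M \<inter> N)"
  by (simp add: open_normal_def normal_inv_iff subgroups_Inter_pair openin_Int)

lemma open_normal_conj:
  "open_normal N \<Longrightarrow> n \<in> N \<Longrightarrow> g \<in> carrier G \<Longrightarrow> conj_by n g \<in> N"
  by (simp add: open_normal_def normal.inv_op_closed1)

lemma open_normal_conj':
  "open_normal N \<Longrightarrow> n \<in> N \<Longrightarrow> g \<in> carrier G \<Longrightarrow> g \<otimes> n \<otimes> inv g \<in> N"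
  by (simp add: open_normal_def normal.inv_op_closed2)

lemma open_normal_finite_inter:
  assumes "finite I" "\<And>i. i \<in> I \<Longrightarrow> open_normal (N i)"
  shows "\<exists>M. open_normal M \<and> (\<forall>i\<in>I. M \<subseteq> N i)"
  using assms
proof (induction I)
  case empty
  show ?case using open_normal_carrier by blast
next
  case (insert i I)
  then obtain M where "open_normal M" "\<forall>i\<in>I. M \<subseteq> N i" by auto
  then show ?case
    using insert.prems by (intro exI[of _ "N i \<inter> M"]) (auto intro: open_normal_Int)
qed

end

context profinite_group
begin

lemma clopen_neighbourhood:
  assumes W: "openin T W" and x: "x \<in> W"
  shows "\<exists>V. openin T V \<and> closedin T V \<and> x \<in> V \<and> V \<subseteq> W"
proof -
  have xT: "x \<in> topspace T"
    using W x openin_subset by blast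
  have "connected_component_of_set T x \<in> connected_components_of T"
    using xT by (simp add: connected_components_of_def)
  then obtain y where "connected_component_of_set T x = {y}"
    using totally_disconnected unfolding totally_disconnected_space_def by blast
  moreover have "x \<in> connected_component_of_set T x"
    using xT by (simp add: connected_component_of_refl)
  ultimately have "connected_component_of_set T x = {x}"
    by simp
  then have "quasi_component_of_set T x = {x}"
    using quasi_eq_connected_component_of[of T x] compact Hausdorff by simp
  then have "{x} \<in> quasi_components_of T"
    using quasi_component_in_quasi_components_of[of T x] xT by simp
  moreover have "compactin T (topspace T - W)"
    using compact W closedin_compact_space by blast
  ultimately have "separated_between T {x} (topspace T - W)"
    using x by (simp add: separated_between_quasi_component_compact disjnt_iff)
  then obtain V where "openin T V" "closedin T V" "x \<in> V" "topspace T - W \<subseteq> topspace T - V"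
    unfolding separated_between by auto
  then show ?thesis
    using openin_subset[of T V] by (intro exI[of _ V]) auto
qed

text \<open>A clopen set \<open>V\<close> around \<open>\<one>\<close> contains the normal subgroup of those elements that can be
  inserted anywhere into a product without affecting membership in \<open>V\<close>. It is open because its
  complement is the projection, along a compact factor, of a closed set.\<close>

lemma open_normal_neighbourhood:
  assumes W: "openin T W" and one: "\<one> \<in> W"
  shows "\<exists>N. open_normal N \<and> N \<subseteq> W"
proof -
  obtain V where V: "openin T V" "closedin T V" "\<one> \<in> V" "V \<subseteq> W"
    using clopen_neighbourhood[OF W one] by blast
  define N where
    "N = {g \<in> carrier G. \<forall>x\<in>carrier G. \<forall>y\<in>carrier G. x \<otimes> g \<otimes> y \<in> V \<longleftrightarrow> x \<otimes> y \<in> V}"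
  have Nc: "g \<in> carrier G" if "g \<in> N" for g
    using that by (simp add: N_def)
  have N: "x \<otimes> (g \<otimes> y) \<in> V \<longleftrightarrow> x \<otimes> y \<in> V"
    if "g \<in> N" "x \<in> carrier G" "y \<in> carrier G" for g x y
    using that by (auto simp: N_def simp flip: m_assoc)
  have NI: "g \<in> N"
    if "g \<in> carrier G"
      "\<And>x y. x \<in> carrier G \<Longrightarrow> y \<in> carrier G \<Longrightarrow> x \<otimes> (g \<otimes> y) \<in> V \<longleftrightarrow> x \<otimes> y \<in> V" for g
    using that by (simp add: N_def m_assoc)
  have sub: "subgroup N G"
  proof
    show "N \<subseteq> carrier G" using Nc by blast
    show "\<one> \<in> N" by (rule NI) auto
    show "g \<otimes> h \<in> N" if "g \<in> N" "h \<in> N" for g h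
      using that Nc N by (intro NI) (simp_all add: m_assoc)
    show "inv g \<in> N" if g: "g \<in> N" for g
    proof (rule NI)
      show "x \<otimes> (inv g \<otimes> y) \<in> V \<longleftrightarrow> x \<otimes> y \<in> V"
        if "x \<in> carrier G" "y \<in> carrier G" for x y
        using N[OF g, of x "inv g \<otimes> y"] that Nc[OF g] by simp
    qed (use Nc[OF g] in simp)
  qed
  have "a \<otimes> g \<otimes> inv a \<in> N" if a: "a \<in> carrier G" and g: "g \<in> N" for a g
  proof (rule NI)
    show "x \<otimes> (a \<otimes> g \<otimes> inv a \<otimes> y) \<in> V \<longleftrightarrow> x \<otimes> y \<in> V"
      if "x \<in> carrier G" "y \<in> carrier G" for x y
      using N[OF g, of "x \<otimes> a" "inv a \<otimes> y"] that a Nc[OF g] by (simp add: m_assoc)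
  qed (use a Nc[OF g] in simp)
  with sub have normal: "N \<lhd> G"
    by (simp add: normal_inv_iff)
  define P where "P = prod_topology T (prod_topology T T)"
  define L where "L = {z \<in> topspace P. fst (snd z) \<otimes> fst z \<otimes> snd (snd z) \<in> V}"
  define R where "R = {z \<in> topspace P. fst (snd z) \<otimes> snd (snd z) \<in> V}"
  have cont: "continuous_map P T (\<lambda>z. fst (snd z))" "continuous_map P T (\<lambda>z. snd (snd z))"
    "continuous_map P T fst"
    unfolding P_def
    using continuous_map_compose[OF continuous_map_snd continuous_map_fst]
      continuous_map_compose[OF continuous_map_snd continuous_map_snd]
    by (simp_all add: o_def continuous_map_fst)
  have cont': "continuous_map P T (\<lambda>z. fst (snd z) \<otimes> fst z \<otimes> snd (snd z))"
    "continuous_map P T (\<lambda>z. fst (snd z) \<otimes> snd (snd z))"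
    by (intro continuous_map_mult cont)+
  have LR: "openin P L" "closedin P L" "openin P R" "closedin P R"
    unfolding L_def R_def
    using openin_continuous_map_preimage[OF _ V(1)] closedin_continuous_map_preimage[OF _ V(2)] cont'
    by blast+
  have "closedin P ((L - R) \<union> (R - L))"
    using LR by (intro closedin_Un closedin_diff)
  moreover have "closed_map P T fst"
    unfolding P_def using compact by (simp add: closed_map_fst compact_space_prod_topology)
  ultimately have "closedin T (fst ` ((L - R) \<union> (R - L)))"
    by (simp add: closed_map_def)
  moreover have "fst ` ((L - R) \<union> (R - L)) = topspace T - N"
  proof -
    have mem: "(g, x, y) \<in> (L - R) \<union> (R - L) \<longleftrightarrow>
        g \<in> carrier G \<and> x \<in> carrier G \<and> y \<in> carrier G \<and> (x \<otimes> g \<otimes> y \<in> V) \<noteq> (x \<otimes> y \<in> V)" for g x y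
      by (auto simp: L_def R_def P_def topspace_eq_carrier)
    have im: "fst ` S = {g. \<exists>x y. (g, x, y) \<in> S}" for S :: "('a \<times> 'a \<times> 'a) set"
      unfolding image_def Bex_def by auto
    show ?thesis
      unfolding im mem by (auto simp: N_def topspace_eq_carrier)
  qed
  ultimately have "openin T N"
    using sub by (simp add: openin_closedin_eq topspace_eq_carrier subgroup.subset)
  moreover have "N \<subseteq> V"
    using V(3) N[of _ \<one> \<one>] Nc by auto
  ultimately show ?thesis
    using normal V(4) by (auto simp: open_normal_def)
qed

lemma finite_rcosets_open_normal:
  assumes N: "open_normal N"
  shows "finite (rcosets N)"
proof -
  have sub: "subgroup N G" using N by (rule open_normal_subgroup)
  have "openin T U" if "U \<in> rcosets N" for U
    using that N by (auto simp: RCOSETS_def open_normal_def openin_rcoset)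
  moreover have "topspace T \<subseteq> \<Union>(rcosets N)"
    using rcosets_part_G[OF sub] topspace_eq_carrier by simp
  ultimately obtain \<F> where \<F>: "finite \<F>" "\<F> \<subseteq> rcosets N" "topspace T \<subseteq> \<Union>\<F>"
    using compact unfolding compact_space_alt by (metis (no_types, lifting))
  have "U \<in> \<F>" if U: "U \<in> rcosets N" for U
  proof -
    obtain x where x: "x \<in> U"
      using U subgroup.rcosets_non_empty[OF sub] by blast
    then have "x \<in> topspace T"
      using U rcosets_part_G[OF sub] topspace_eq_carrier by blast
    then obtain U' where "U' \<in> \<F>" "x \<in> U'"
      using \<F>(3) by blast
    then have "U = U'"
      using pairwiseD[OF rcos_disjoint[OF sub] U, of U'] \<F>(2) x by (auto simp: disjnt_iff)
    with \<open>U' \<in> \<F>\<close> show ?thesis by simp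
  qed
  then have "rcosets N \<subseteq> \<F>"
    by blast
  then show ?thesis
    using \<F>(1) by (rule finite_subset)
qed

end

lemma (in group) pow_card_rcosets_mem:
  assumes N: "N \<lhd> G" and g: "g \<in> carrier G"
  shows "g [^] card (rcosets N) \<in> N"
proof -
  interpret N: normal N G by (rule N)
  have hom: "group_hom G (G Mod N) (\<lambda>a. N #> a)"
    using N.factorgroup_is_group N.r_coset_hom_Mod by (simp add: group_hom_def group_hom_axioms_def is_group)
  have "N #> (g [^] card (rcosets N)) = (N #> g) [^]\<^bsub>G Mod N\<^esub> card (rcosets N)"
    using group_hom.hom_nat_pow[OF hom g] by simp
  also have "\<dots> = \<one>\<^bsub>G Mod N\<^esub>"
    using group.pow_order_eq_1[OF N.factorgroup_is_group, of "N #> g"] g N.subset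
    by (auto simp: order_def FactGroup_def rcosetsI)
  finally have "N #> (g [^] card (rcosets N)) = N"
    by (simp add: FactGroup_def)
  then show ?thesis
    using rcos_self[OF nat_pow_closed[OF g] N.subgroup_axioms] by metis
qed

section \<open>Germs of commutator maps\<close>

lemma (in group) rcoset_conj:
  assumes H: "H \<lhd> G" and c: "a \<in> carrier G" "x \<in> carrier G" "b \<in> carrier G" "y \<in> carrier G"
    and eq: "H #> a = H #> x" "H #> b = H #> y"
  shows "H #> conj_by a b = H #> conj_by x y"
proof -
  interpret H: normal H G by (rule H)
  have conj: "H #> conj_by u v = (H #> inv v) <#> (H #> u) <#> (H #> v)"
    if "u \<in> carrier G" "v \<in> carrier G" for u v
    using that by (simp add: H.rcos_sum)
  show ?thesis
    unfolding conj[OF c(1,3)] conj[OF c(2,4)] eq using H.rcos_inv[OF c(3)] H.rcos_inv[OF c(4)] eq by simp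
qed

context topological_group
begin

text \<open>This concerns the germ at \<open>\<one>\<close> of the map \<open>n \<mapsto> [x, n]\<close>, since only small \<open>n\<close> matter.\<close>

definition germ_in :: "'a \<Rightarrow> 'a set \<Rightarrow> bool" where
  "germ_in x K \<longleftrightarrow> (\<exists>N. open_normal N \<and> (\<forall>n\<in>N. commutator G x n \<in> K))"

lemma germ_in_mono: "germ_in x K \<Longrightarrow> K \<subseteq> L \<Longrightarrow> germ_in x L"
  unfolding germ_in_def by blast

lemma germ_in_Int:
  assumes "germ_in x K" "germ_in x L" shows "germ_in x (K \<inter> L)"
proof -
  obtain M N where "open_normal M" "\<forall>n\<in>M. commutator G x n \<in> K"
    "open_normal N" "\<forall>n\<in>N. commutator G x n \<in> L"
    using assms unfolding germ_in_def by blast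
  then show ?thesis
    unfolding germ_in_def by (intro exI[of _ "M \<inter> N"]) (auto intro: open_normal_Int)
qed

lemma open_normal_memD: "open_normal N \<Longrightarrow> n \<in> N \<Longrightarrow> n \<in> carrier G"
  using open_normal_subgroup[of N] subgroup.mem_carrier[of N G n] by simp

lemma germ_in_conj:
  assumes x: "x \<in> carrier G" and g: "g \<in> carrier G"
  shows "germ_in (conj_by x g) K \<longleftrightarrow> germ_in x {k \<in> carrier G. conj_by k g \<in> K}"
proof -
  have eq: "(\<forall>m\<in>N. commutator G (conj_by x g) m \<in> K) \<longleftrightarrow>
      (\<forall>n\<in>N. commutator G x n \<in> {k \<in> carrier G. conj_by k g \<in> K})" if N: "open_normal N" for N
  proof
    assume *: "\<forall>m\<in>N. commutator G (conj_by x g) m \<in> K"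
    show "\<forall>n\<in>N. commutator G x n \<in> {k \<in> carrier G. conj_by k g \<in> K}"
    proof
      fix n assume n: "n \<in> N"
      then show "commutator G x n \<in> {k \<in> carrier G. conj_by k g \<in> K}"
        using * open_normal_conj[OF N n g] open_normal_memD[OF N n] x g
        by (simp add: conj_commutator)
    qed
  next
    assume *: "\<forall>n\<in>N. commutator G x n \<in> {k \<in> carrier G. conj_by k g \<in> K}"
    show "\<forall>m\<in>N. commutator G (conj_by x g) m \<in> K"
    proof
      fix m assume m: "m \<in> N"
      define n where "n = g \<otimes> m \<otimes> inv g"
      have n: "n \<in> N" "n \<in> carrier G" "conj_by n g = m"
        using open_normal_conj'[OF N m g] open_normal_memD[OF N m] g
        by (simp_all add: n_def m_assoc)
      then have "conj_by (commutator G x n) g \<in> K"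
        using * by blast
      then show "commutator G (conj_by x g) m \<in> K"
        using n x g by (simp add: conj_commutator)
    qed
  qed
  show ?thesis
    unfolding germ_in_def using eq by blast
qed

text \<open>By the identity \<open>[x y, n] = [x, n]\<^sup>y [y, n] = [x\<^sup>y, n\<^sup>y] [y, n]\<close>, a subgroup that contains two
  of the germs of \<open>x y\<close>, \<open>x\<^sup>y\<close> and \<open>y\<close> contains the third.\<close>

lemma germ_in_mult:
  assumes K: "subgroup K G" and xy: "x \<in> carrier G" "y \<in> carrier G"
  shows "germ_in (conj_by x y) K \<Longrightarrow> germ_in y K \<Longrightarrow> germ_in (x \<otimes> y) K"
    and "germ_in (x \<otimes> y) K \<Longrightarrow> germ_in y K \<Longrightarrow> germ_in (conj_by x y) K"
    and "germ_in (x \<otimes> y) K \<Longrightarrow> germ_in (conj_by x y) K \<Longrightarrow> germ_in y K"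
proof -
  define K' where "K' = {k \<in> carrier G. conj_by k y \<in> K}"
  have conj: "germ_in (conj_by x y) K \<longleftrightarrow> germ_in x K'"
    using germ_in_conj xy unfolding K'_def by blast
  have split: "commutator G (x \<otimes> y) n = conj_by (commutator G x n) y \<otimes> commutator G y n"
    and cl: "commutator G x n \<in> carrier G" "commutator G y n \<in> carrier G"
      "conj_by (commutator G x n) y \<in> carrier G" if "n \<in> carrier G" for n
    using that xy by (simp_all add: commutator_mult_left)
  have common: "germ_in a L \<Longrightarrow> germ_in b M \<Longrightarrow>
      (\<And>n. n \<in> carrier G \<Longrightarrow> commutator G a n \<in> L \<Longrightarrow> commutator G b n \<in> M \<Longrightarrow> commutator G c n \<in> R)
      \<Longrightarrow> germ_in c R" for a b c L M R
  proof -
    assume "germ_in a L" "germ_in b M" and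
      *: "\<And>n. n \<in> carrier G \<Longrightarrow> commutator G a n \<in> L \<Longrightarrow> commutator G b n \<in> M \<Longrightarrow> commutator G c n \<in> R"
    then obtain N N' where "open_normal N" "\<forall>n\<in>N. commutator G a n \<in> L"
      "open_normal N'" "\<forall>n\<in>N'. commutator G b n \<in> M"
      unfolding germ_in_def by blast
    then show "germ_in c R"
      unfolding germ_in_def
      by (intro exI[of _ "N \<inter> N'"]) (auto intro: open_normal_Int * open_normal_memD)
  qed
  show "germ_in (conj_by x y) K \<Longrightarrow> germ_in y K \<Longrightarrow> germ_in (x \<otimes> y) K"
    unfolding conj
    by (rule common[of x K' y K]) (use split K'_def K subgroup.m_closed in auto)
  show "germ_in (x \<otimes> y) K \<Longrightarrow> germ_in y K \<Longrightarrow> germ_in (conj_by x y) K"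
    unfolding conj
  proof (rule common[of "x \<otimes> y" K y K])
    fix n assume n: "n \<in> carrier G" "commutator G (x \<otimes> y) n \<in> K" "commutator G y n \<in> K"
    have "conj_by (commutator G x n) y = commutator G (x \<otimes> y) n \<otimes> inv (commutator G y n)"
      using split[OF n(1)] cl[OF n(1)] by (simp add: m_assoc del: commutator_closed)
    then show "commutator G x n \<in> K'"
      using n K cl[OF n(1)] by (simp add: K'_def subgroup.m_closed subgroup.m_inv_closed)
  qed
  show "germ_in (x \<otimes> y) K \<Longrightarrow> germ_in (conj_by x y) K \<Longrightarrow> germ_in y K"
    unfolding conj
  proof (rule common[of "x \<otimes> y" K x K'])
    fix n assume n: "n \<in> carrier G" "commutator G (x \<otimes> y) n \<in> K" "commutator G x n \<in> K'"
    have "commutator G y n = inv (conj_by (commutator G x n) y) \<otimes> commutator G (x \<otimes> y) n"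
      using split[OF n(1)] cl[OF n(1)] by simp
    then show "commutator G y n \<in> K"
      using n K by (simp add: K'_def subgroup.m_closed subgroup.m_inv_closed del: inv_mult_group)
  qed
qed

definition germ_equiv :: "'a \<Rightarrow> 'a \<Rightarrow> bool" where
  "germ_equiv x y \<longleftrightarrow> (\<forall>K. subgroup K G \<longrightarrow> closedin T K \<longrightarrow> germ_in x K = germ_in y K)"

lemma closed_subgroup_conj_preimage:
  assumes K: "subgroup K G" "closedin T K" and g: "g \<in> carrier G"
  shows "subgroup {k \<in> carrier G. conj_by k g \<in> K} G" "closedin T {k \<in> carrier G. conj_by k g \<in> K}"
proof -
  show "subgroup {k \<in> carrier G. conj_by k g \<in> K} G"
  proof
    show "\<one> \<in> {k \<in> carrier G. conj_by k g \<in> K}"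
      using g subgroup.one_closed[OF K(1)] by simp
    show "x \<otimes> y \<in> {k \<in> carrier G. conj_by k g \<in> K}"
      if "x \<in> {k \<in> carrier G. conj_by k g \<in> K}" "y \<in> {k \<in> carrier G. conj_by k g \<in> K}" for x y
    proof -
      have "conj_by (x \<otimes> y) g = conj_by x g \<otimes> conj_by y g"
        using that g by (simp add: m_assoc)
      then show ?thesis using that subgroup.m_closed[OF K(1)] by simp
    qed
    show "inv x \<in> {k \<in> carrier G. conj_by k g \<in> K}"
      if "x \<in> {k \<in> carrier G. conj_by k g \<in> K}" for x
    proof -
      have "conj_by (inv x) g = inv (conj_by x g)"
        using that g by (simp add: word_simps)
      then show ?thesis using that subgroup.m_inv_closed[OF K(1)] by simp
    qed
  qed auto
  have "continuous_map T T (\<lambda>k. conj_by k g)"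
    using g by (intro continuous_map_mult) (simp_all add: topspace_eq_carrier)
  from closedin_continuous_map_preimage[OF this K(2)]
  show "closedin T {k \<in> carrier G. conj_by k g \<in> K}"
    by (simp add: topspace_eq_carrier)
qed

lemma germ_equiv_conj:
  assumes "germ_equiv x y" and "x \<in> carrier G" "y \<in> carrier G" "g \<in> carrier G"
  shows "germ_equiv (conj_by x g) (conj_by y g)"
  unfolding germ_equiv_def
proof (intro allI impI)
  fix K assume "subgroup K G" "closedin T K"
  note K' = closed_subgroup_conj_preimage[OF this assms(4)]
  show "germ_in (conj_by x g) K = germ_in (conj_by y g) K"
    unfolding germ_in_conj[OF assms(2,4)] germ_in_conj[OF assms(3,4)]
    using assms(1) K' by (simp add: germ_equiv_def)
qed

lemma germ_in_abelian_coset: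
  assumes A: "open_normal A" and abelian: "\<And>a b. a \<in> A \<Longrightarrow> b \<in> A \<Longrightarrow> commutator G a b = \<one>"
    and x: "x \<in> carrier G" and h: "h \<in> A"
  shows "germ_in (h \<otimes> x) K \<longleftrightarrow> germ_in x K"
proof -
  have eq: "commutator G (h \<otimes> x) n = commutator G x n" if "n \<in> A" for n
    using that abelian[OF h that] x open_normal_memD[OF A] h by (simp add: commutator_mult_left)
  have transfer: "germ_in v K" if germ: "germ_in u K"
    and same: "\<And>n. n \<in> A \<Longrightarrow> commutator G u n = commutator G v n" for u v
  proof -
    obtain N where "open_normal N" "\<forall>n\<in>N. commutator G u n \<in> K"
      using germ unfolding germ_in_def by blast
    then show ?thesis
      unfolding germ_in_def using A same
      by (intro exI[of _ "N \<inter> A"]) (auto intro: open_normal_Int)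
  qed
  show ?thesis
    using transfer[of x "h \<otimes> x"] transfer[of "h \<otimes> x" x] eq by auto
qed

text \<open>A box of commutators \<open>[a N, b N]\<close> inside a subgroup: quotients of its elements with the same
  first entry are commutators of elements of the coset \<open>a\<^sup>b N\<close> with elements of \<open>N\<close>.\<close>

lemma commutator_box:
  assumes C: "subgroup C G" and N: "open_normal N" and ab: "a \<in> carrier G" "b \<in> carrier G"
    and box: "\<And>n m. n \<in> N \<Longrightarrow> m \<in> N \<Longrightarrow> commutator G (a \<otimes> n) (b \<otimes> m) \<in> C"
    and n: "n \<in> N" and m: "m \<in> N"
  shows "commutator G (conj_by a b \<otimes> n) m \<in> C"
proof -
  note [simp] = open_normal_memD[OF N n] open_normal_memD[OF N m] ab
  define u where "u = a \<otimes> (b \<otimes> n \<otimes> inv b)"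
  have one: "\<one> \<in> N"
    using subgroup.one_closed[OF open_normal_subgroup[OF N]] .
  have "commutator G u (b \<otimes> \<one>) \<in> C" "commutator G u (b \<otimes> m) \<in> C"
    unfolding u_def using open_normal_conj'[OF N n ab(2)] m one by (blast intro: box)+
  then have "inv (commutator G u (b \<otimes> \<one>)) \<otimes> commutator G u (b \<otimes> m) \<in> C"
    using C by (simp add: subgroup.m_closed subgroup.m_inv_closed)
  also have "inv (commutator G u (b \<otimes> \<one>)) \<otimes> commutator G u (b \<otimes> m) = commutator G (conj_by a b \<otimes> n) m"
    by (simp add: u_def commutator_def word_simps)
  finally show ?thesis .
qed

text \<open>The germ at \<open>a\<^sup>b\<close> gives the germ at \<open>b\<^sup>a\<close> by exchanging the entries. Since \<open>[n, z m] \<in> C\<close> for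
  \<open>z = a\<^sup>b\<close>, there is also a box based at the pair \<open>(\<one>, z)\<close>, and \<open>\<one>\<^sup>z = \<one>\<close>.\<close>

lemma commutator_box_consequences:
  assumes C: "subgroup C G" and N: "open_normal N" and ab: "a \<in> carrier G" "b \<in> carrier G"
    and box: "\<And>n m. n \<in> N \<Longrightarrow> m \<in> N \<Longrightarrow> commutator G (a \<otimes> n) (b \<otimes> m) \<in> C"
  shows "germ_in (conj_by a b) C" "germ_in (conj_by b a) C"
    and "\<And>n m. n \<in> N \<Longrightarrow> m \<in> N \<Longrightarrow> commutator G n m \<in> C"
proof -
  note Nc = open_normal_memD[OF N]
  have one: "\<one> \<in> N"
    using subgroup.one_closed[OF open_normal_subgroup[OF N]] .
  have swap: "commutator G v u \<in> C" if "commutator G u v \<in> C" "u \<in> carrier G" "v \<in> carrier G" for u v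
    using subgroup.m_inv_closed[OF C that(1)] inv_commutator[OF that(2,3)] by simp
  have left: "commutator G (conj_by a b \<otimes> n) m \<in> C" if "n \<in> N" "m \<in> N" for n m
    by (rule commutator_box[OF C N ab box that])
  have right: "commutator G (conj_by b a \<otimes> n) m \<in> C" if "n \<in> N" "m \<in> N" for n m
    by (rule commutator_box[OF C N ab(2,1) _ that]) (use box swap ab Nc in simp)
  show "germ_in (conj_by a b) C" "germ_in (conj_by b a) C"
    unfolding germ_in_def using left[OF one] right[OF one] ab N
    by (auto intro!: exI[of _ N])
  fix n m assume nm: "n \<in> N" "m \<in> N"
  have "commutator G (conj_by \<one> (conj_by a b) \<otimes> n) m \<in> C"
  proof (rule commutator_box[OF C N _ _ _ nm])
    fix n m assume "n \<in> N" "m \<in> N"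
    then show "commutator G (\<one> \<otimes> n) (conj_by a b \<otimes> m) \<in> C"
      using swap[OF left[of m n]] Nc ab by simp
  qed (use ab in simp_all)
  then show "commutator G n m \<in> C"
    using ab Nc nm by simp
qed

end

context profinite_group
begin

lemma germ_in_neighbourhood:
  assumes W: "openin T W" "\<one> \<in> W" and x: "x \<in> carrier G"
  shows "germ_in x W"
proof -
  define U where "U = {n \<in> topspace T. commutator G x n \<in> W}"
  have "continuous_map T T (\<lambda>n. commutator G x n)"
    using x by (intro continuous_map_commutator) (simp_all add: topspace_eq_carrier)
  from openin_continuous_map_preimage[OF this W(1)] have "openin T U"
    by (simp add: U_def)
  moreover have "\<one> \<in> U"
    using x W(2) by (simp add: U_def commutator_def topspace_eq_carrier)
  ultimately obtain N where "open_normal N" "N \<subseteq> U"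
    using open_normal_neighbourhood by meson
  then show ?thesis
    unfolding germ_in_def U_def by (intro exI[of _ N]) auto
qed

end

section \<open>Covering commutators by uniserial subgroups\<close>

text \<open>Procyclic pro-\<open>p\<close> groups are uniserial in the sense required here because they are quotients
  of \<open>\<int>\<^sub>p\<close>, in which every nonzero closed subgroup is some \<open>p\<^sup>k\<int>\<^sub>p\<close>.\<close>

locale commutator_cover = profinite_group +
  fixes \<C> :: "'a set set"
  assumes countable_cover: "countable \<C>"
    and cover_subgroup: "C \<in> \<C> \<Longrightarrow> subgroup C G"
    and cover_closed: "C \<in> \<C> \<Longrightarrow> closedin T C"
    and cover_uniserial: "\<lbrakk>C \<in> \<C>; subgroup P G; closedin T P; P \<subseteq> C; P \<noteq> {\<one>}\<rbrakk> \<Longrightarrow>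
      \<exists>W. openin T W \<and> \<one> \<in> W \<and> W \<inter> C \<subseteq> P"
    and cover: "commutators G \<subseteq> \<Union>\<C>"
begin

text \<open>Baire's theorem: the sets of pairs whose commutator lies in \<open>C\<close> form a countable closed cover of
  \<open>G \<times> G\<close>. Removing the interior from each of them leaves nowhere dense sets, which cannot cover the
  open set of pairs with prescribed cosets modulo \<open>M\<close>.\<close>

lemma commutator_box_exists:
  assumes x: "x \<in> carrier G" and y: "y \<in> carrier G" and M: "open_normal M"
  shows "\<exists>C\<in>\<C>. \<exists>a\<in>carrier G. \<exists>b\<in>carrier G. \<exists>N. open_normal N \<and> N \<subseteq> M \<and>
      M #> a = M #> x \<and> M #> b = M #> y \<and>
      (\<forall>n\<in>N. \<forall>m\<in>N. commutator G (a \<otimes> n) (b \<otimes> m) \<in> C)"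
proof -
  define X where "X = prod_topology T T"
  have topX: "topspace X = carrier G \<times> carrier G"
    by (simp add: X_def topspace_eq_carrier)
  have cont: "continuous_map X T fst" "continuous_map X T snd"
    by (simp_all add: X_def continuous_map_fst continuous_map_snd)
  define F where "F C = {z \<in> topspace X. commutator G (fst z) (snd z) \<in> C}" for C
  have F: "closedin X (F C)" if "C \<in> \<C>" for C
    unfolding F_def using continuous_map_commutator[OF cont] cover_closed[OF that]
    by (rule closedin_continuous_map_preimage)
  define S where "S = {z \<in> topspace X. fst z \<otimes> inv x \<in> M} \<inter> {z \<in> topspace X. snd z \<otimes> inv y \<in> M}"
  have S: "openin X S"
    unfolding S_def
  proof (intro openin_Int openin_continuous_map_preimage[where Y = T])
    show "continuous_map X T (\<lambda>z. fst z \<otimes> inv x)" "continuous_map X T (\<lambda>z. snd z \<otimes> inv y)"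
      using x y cont by (auto intro!: continuous_map_mult simp: topspace_eq_carrier)
    show "openin T M" "openin T M" using M by (simp_all add: open_normal_def)
  qed
  have xyS: "(x, y) \<in> S"
    using x y subgroup.one_closed[OF open_normal_subgroup[OF M]] by (simp add: S_def topX)
  \<comment> \<open>The part of \<open>F C\<close> that Baire's theorem allows to discard.\<close>
  define B where "B C = F C - X interior_of F C" for C
  have "X interior_of \<Union>(B ` \<C>) = {}"
  proof (rule Baire_category_alt)
    have "compact_space X" "Hausdorff_space X"
      using compact Hausdorff by (simp_all add: X_def compact_space_prod_topology Hausdorff_space_prod_topology)
    then show "completely_metrizable_space X \<or> locally_compact_space X \<and> regular_space X"
      using compact_imp_locally_compact_space compact_Hausdorff_imp_regular_space by blast
    show "countable (B ` \<C>)" using countable_cover by simp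
    fix U assume "U \<in> B ` \<C>"
    then obtain C where C: "C \<in> \<C>" "U = B C" by blast
    have "X interior_of (B C) \<subseteq> X interior_of (F C)"
      by (intro interior_of_mono) (auto simp: B_def)
    moreover have "X interior_of (B C) \<subseteq> B C"
      by (rule interior_of_subset)
    ultimately have "X interior_of (B C) = {}"
      by (auto simp: B_def)
    moreover have "closedin X (B C)"
      unfolding B_def by (intro closedin_diff F C openin_interior_of)
    ultimately show "closedin X U \<and> X interior_of U = {}"
      using C by simp
  qed
  then have "\<not> S \<subseteq> \<Union>(B ` \<C>)"
    using interior_of_maximal[OF _ S] xyS by blast
  then obtain z where z: "z \<in> S" "z \<notin> \<Union>(B ` \<C>)" by blast
  have "commutator G (fst z) (snd z) \<in> commutators G"
  proof -
    have "fst z \<in> carrier G" "snd z \<in> carrier G"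
      using z(1) by (auto simp: S_def topX)
    then show ?thesis unfolding commutators_def by blast
  qed
  then obtain C where C: "C \<in> \<C>" "commutator G (fst z) (snd z) \<in> C"
    using cover by blast
  have "z \<in> F C" using C z(1) by (auto simp: F_def S_def)
  then have zI: "z \<in> X interior_of F C \<inter> S"
    using z C(1) by (auto simp: B_def)
  obtain a b where ab: "z = (a, b)" by (cases z)
  define Z where "Z = X interior_of F C \<inter> S"
  have Z: "openin X Z" "Z \<subseteq> F C" "(a, b) \<in> Z"
    using S zI ab interior_of_subset[of X "F C"] by (auto simp: Z_def openin_Int)
  from Z(1,3) have "\<exists>U V. openin T U \<and> openin T V \<and> a \<in> U \<and> b \<in> V \<and> U \<times> V \<subseteq> Z"
    unfolding X_def openin_prod_topology_alt by simp
  then obtain U V where UV: "openin T U" "openin T V" "a \<in> U" "b \<in> V" "U \<times> V \<subseteq> Z"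
    by auto
  have abc: "a \<in> carrier G" "b \<in> carrier G"
    using openin_carrier[OF UV(1)] openin_carrier[OF UV(2)] UV(3,4) by auto
  have nbhd: "\<exists>N. open_normal N \<and> (\<forall>n\<in>N. a \<otimes> n \<in> U)" if U: "openin T U" "a \<in> U" for a U
  proof -
    have a: "a \<in> carrier G" using U openin_carrier[of U] by blast
    have "continuous_map T T (\<lambda>n. a \<otimes> n)"
      using a by (intro continuous_map_mult) (simp_all add: topspace_eq_carrier)
    from openin_continuous_map_preimage[OF this U(1)]
    obtain N where "open_normal N" "N \<subseteq> {n \<in> topspace T. a \<otimes> n \<in> U}"
      using open_normal_neighbourhood[of "{n \<in> topspace T. a \<otimes> n \<in> U}"] U a
      by (auto simp: topspace_eq_carrier)
    then show ?thesis by blast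
  qed
  obtain N1 N2 where N: "open_normal N1" "\<forall>n\<in>N1. a \<otimes> n \<in> U" "open_normal N2" "\<forall>n\<in>N2. b \<otimes> n \<in> V"
    using nbhd UV by meson
  have coset: "M #> a = M #> x" if "a \<in> carrier G" "x \<in> carrier G" "a \<otimes> inv x \<in> M" for a x
  proof -
    have "a = (a \<otimes> inv x) \<otimes> x" using that by (simp add: m_assoc)
    then have "a \<in> M #> x" using that unfolding r_coset_def by blast
    then show ?thesis
      using repr_independence[OF _ that(2) open_normal_subgroup[OF M]] by simp
  qed
  show ?thesis
  proof (rule bexI[OF _ C(1)], rule bexI[OF _ abc(1)], rule bexI[OF _ abc(2)],
      intro exI[of _ "M \<inter> (N1 \<inter> N2)"] conjI ballI)
    show "open_normal (M \<inter> (N1 \<inter> N2))" using M N by (intro open_normal_Int)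
    show "M #> a = M #> x" "M #> b = M #> y"
      using coset[OF abc(1) x] coset[OF abc(2) y] z(1) by (simp_all add: S_def ab)
    fix n m assume "n \<in> M \<inter> (N1 \<inter> N2)" "m \<in> M \<inter> (N1 \<inter> N2)"
    then have "(a \<otimes> n, b \<otimes> m) \<in> F C"
      using N UV(5) Z(2) by blast
    then show "commutator G (a \<otimes> n) (b \<otimes> m) \<in> C"
      by (simp add: F_def)
  qed auto
qed

text \<open>Since \<open>C\<close> is uniserial, \<open>K \<inter> C\<close> is open in \<open>C\<close>, so a germ cannot tell \<open>C\<close> from \<open>K \<inter> C\<close>.\<close>

lemma germ_in_transfer:
  assumes C: "C \<in> \<C>" and K: "subgroup K G" "closedin T K" and x: "x \<in> carrier G"
    and germ: "germ_in x C" and ne: "K \<inter> C \<noteq> {\<one>}"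
  shows "germ_in x K"
proof -
  have "\<exists>W. openin T W \<and> \<one> \<in> W \<and> W \<inter> C \<subseteq> K \<inter> C"
    using K C ne by (intro cover_uniserial)
      (auto intro: closedin_Int cover_closed subgroups_Inter_pair cover_subgroup)
  then obtain W where W: "openin T W" "\<one> \<in> W" "W \<inter> C \<subseteq> K \<inter> C" by blast
  have "germ_in x W"
    using germ_in_neighbourhood[OF W(1,2) x] .
  from germ_in_Int[OF this germ] show ?thesis
    using W(3) by (auto intro: germ_in_mono)
qed

text \<open>The identity \<open>[h z, n] = [h, n]\<^sup>z [z, n]\<close> spreads a germ over a coset of \<open>H\<close>, and there
  are only finitely many cosets.\<close>

lemma uniform_germ:
  assumes C: "subgroup C G" and H: "open_normal H"
    and HC: "\<And>h n. h \<in> H \<Longrightarrow> n \<in> H \<Longrightarrow> commutator G h n \<in> C"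
    and reps: "\<And>x. x \<in> carrier G \<Longrightarrow> \<exists>z\<in>carrier G. H #> z = H #> x \<and> germ_in z C"
  shows "\<exists>N. open_normal N \<and> (\<forall>g\<in>carrier G. \<forall>n\<in>N. commutator G g n \<in> C)"
proof -
  have "\<exists>z N. z \<in> carrier G \<and> H #> z = c \<and> open_normal N \<and> (\<forall>n\<in>N. commutator G z n \<in> C)"
    if "c \<in> rcosets H" for c
    using that reps unfolding RCOSETS_def germ_in_def by fastforce
  then obtain z N where zN: "\<And>c. c \<in> rcosets H \<Longrightarrow> z c \<in> carrier G \<and> H #> z c = c \<and> open_normal (N c) \<and>
      (\<forall>n\<in>N c. commutator G (z c) n \<in> C)"
    by metis
  obtain M where M: "open_normal M" "\<forall>c\<in>rcosets H. M \<subseteq> N c"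
    using open_normal_finite_inter[OF finite_rcosets_open_normal[OF H], of N] zN by blast
  have "commutator G g n \<in> C" if g: "g \<in> carrier G" and n: "n \<in> M \<inter> H" for g n
  proof -
    define c where "c = H #> g"
    have c: "c \<in> rcosets H"
      using g H by (simp add: c_def rcosetsI open_normal_subgroup subgroup.subset)
    have "g \<in> H #> z c"
      using zN[OF c] rcos_self[OF g open_normal_subgroup[OF H]] by (simp add: c_def)
    then obtain h where h: "h \<in> H" "g = h \<otimes> z c"
      by (auto simp: r_coset_def)
    have cl: "h \<in> carrier G" "n \<in> carrier G" "z c \<in> carrier G"
      using h n open_normal_memD[OF H] zN[OF c] by auto
    have "conj_by (commutator G h n) (z c) = commutator G (conj_by h (z c)) (conj_by n (z c))"
      using cl by (simp add: conj_commutator)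
    also have "\<dots> \<in> C"
      using HC open_normal_conj[OF H _ cl(3)] h n by blast
    finally have "conj_by (commutator G h n) (z c) \<in> C" .
    moreover have "commutator G (z c) n \<in> C"
      using zN[OF c] M(2) c n by blast
    ultimately show ?thesis
      using cl C by (simp add: h(2) commutator_mult_left subgroup.m_closed)
  qed
  then show ?thesis
    using open_normal_Int[OF M(1) H] by blast
qed

text \<open>If the germ of \<open>x\<close> is nontrivial and lies in both \<open>C\<close> and \<open>K\<close>, these meet nontrivially, so the
  germ of any other \<open>y\<close> can be transferred from \<open>C\<close> to \<open>K\<close>.\<close>

lemma cover_nontrivial_germ:
  assumes "C \<in> \<C>" "subgroup K G" "closedin T K" "x \<in> carrier G" "y \<in> carrier G"
    and "germ_in x C" "germ_in x K" "\<not> germ_in x {\<one>}" "germ_in y C"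
  shows "germ_in y K"
proof (rule germ_in_transfer)
  show "K \<inter> C \<noteq> {\<one>}"
    using germ_in_Int[OF assms(7,6)] assms(8) by auto
qed (use assms in auto)

text \<open>Here \<open>[H, H] \<subseteq> C\<close> for some open normal \<open>H\<close>. Every member of the cover that arises from Baire's
  theorem inside \<open>H\<close> contains \<open>[N, N]\<close> for a smaller \<open>N\<close>, hence meets \<open>C\<close> nontrivially, and its germs
  can be transferred to \<open>C\<close>.\<close>

lemma uniform_germ_nonabelian:
  assumes nonabelian: "\<And>N. open_normal N \<Longrightarrow> \<exists>n\<in>N. \<exists>m\<in>N. commutator G n m \<noteq> \<one>"
  shows "\<exists>C\<in>\<C>. \<exists>N. open_normal N \<and> (\<forall>g\<in>carrier G. \<forall>n\<in>N. commutator G g n \<in> C)"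
proof -
  obtain C a b H where C: "C \<in> \<C>" and H: "open_normal H" and ab: "a \<in> carrier G" "b \<in> carrier G"
    and box: "\<forall>n\<in>H. \<forall>m\<in>H. commutator G (a \<otimes> n) (b \<otimes> m) \<in> C"
    using commutator_box_exists[OF one_closed one_closed open_normal_carrier] by blast
  have HC: "commutator G n m \<in> C" if "n \<in> H" "m \<in> H" for n m
    using commutator_box_consequences(3)[OF cover_subgroup[OF C] H ab] box that by blast
  have "\<exists>z\<in>carrier G. H #> z = H #> x \<and> germ_in z C" if x: "x \<in> carrier G" for x
  proof -
    obtain C' a b N where C': "C' \<in> \<C>" and N: "open_normal N" "N \<subseteq> H" and ab: "a \<in> carrier G" "b \<in> carrier G"
      and cosets: "H #> a = H #> x" "H #> b = H #> \<one>"
      and box: "\<forall>n\<in>N. \<forall>m\<in>N. commutator G (a \<otimes> n) (b \<otimes> m) \<in> C'"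
      using commutator_box_exists[OF x one_closed H] by blast
    note cons = commutator_box_consequences[OF cover_subgroup[OF C'] N(1) ab]
    have germ: "germ_in (conj_by a b) C'"
      using cons(1) box by blast
    obtain n m where nm: "n \<in> N" "m \<in> N" "commutator G n m \<noteq> \<one>"
      using nonabelian[OF N(1)] by blast
    have "commutator G n m \<in> C \<inter> C'"
      using HC[of n m] cons(3)[of n m] box nm N(2) by blast
    then have "germ_in (conj_by a b) C"
      using nm ab by (intro germ_in_transfer[OF C' cover_subgroup[OF C] cover_closed[OF C] _ germ]) auto
    moreover have "H #> conj_by a b = H #> x"
      using rcoset_conj[OF _ ab(1) x ab(2) one_closed cosets] H x by (simp add: open_normal_def)
    ultimately show ?thesis using ab by blast
  qed
  from uniform_germ[OF cover_subgroup[OF C] H HC this] C show ?thesis by blast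
qed

text \<open>Suppose that bad elements \<open>x\<close> and \<open>y\<close> are not equivalent. Then \<open>x\<^sup>y\<close> is not equivalent to
  \<open>y = y\<^sup>y\<close>. So \<open>x y\<close> is bad, as otherwise the germs of \<open>x\<^sup>y\<close> and \<open>y\<close> would lie in the same subgroups;
  so is its conjugate \<open>y x = (x y)\<^sup>x\<close>. The swapping relation for \<open>y\<close> and \<open>y x\<close> reads
  \<open>y\<^sup>x \<approx> x y\<close>, hence \<open>x\<^sup>y \<approx> y\<^sup>x \<approx> x y\<close>. A member of the cover that contains the germs of \<open>x y\<close> and
  \<open>x\<^sup>y\<close> also contains the germ of \<open>y\<close>, and this forces \<open>x\<^sup>y \<approx> y\<close>, a contradiction.\<close>

lemma uniform_germ_abelian:
  assumes A: "open_normal A" and abelian: "\<And>a b. a \<in> A \<Longrightarrow> b \<in> A \<Longrightarrow> commutator G a b = \<one>"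
  shows "\<exists>C\<in>\<C>. \<exists>N. open_normal N \<and> (\<forall>g\<in>carrier G. \<forall>n\<in>N. commutator G g n \<in> C)"
proof -
  define bad where "bad x \<longleftrightarrow> \<not> germ_in x {\<one>}" for x
  have one_mem: "{\<one>} \<subseteq> K" if "subgroup K G" for K
    using subgroup.one_closed[OF that] by simp
  have coset': "germ_in v K" if eq: "A #> u = A #> v" and uv: "u \<in> carrier G" "v \<in> carrier G"
    and germ: "germ_in u K" for u v K
  proof -
    have "u \<in> A #> v"
      using rcos_self[OF uv(1) open_normal_subgroup[OF A]] eq by simp
    then obtain h where "h \<in> A" "u = h \<otimes> v"
      by (auto simp: r_coset_def)
    then show ?thesis
      using germ_in_abelian_coset[OF A abelian uv(2)] germ by blast
  qed
  \<comment> \<open>A box \<open>[a N, b N]\<close> with \<open>a \<in> A x\<close> and \<open>b \<in> A y\<close>; the change of representatives is harmless.\<close>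
  have pair: "\<exists>C\<in>\<C>. germ_in (conj_by x y) C \<and> germ_in (conj_by y x) C"
    if x: "x \<in> carrier G" and y: "y \<in> carrier G" for x y
  proof -
    obtain C a b N where C: "C \<in> \<C>" and N: "open_normal N" and ab: "a \<in> carrier G" "b \<in> carrier G"
      and cosets: "A #> a = A #> x" "A #> b = A #> y"
      and box: "\<forall>n\<in>N. \<forall>m\<in>N. commutator G (a \<otimes> n) (b \<otimes> m) \<in> C"
      using commutator_box_exists[OF x y A] by blast
    have An: "A \<lhd> G" using A by (simp add: open_normal_def)
    note cons = commutator_box_consequences[OF cover_subgroup[OF C] N ab]
    have "germ_in (conj_by a b) C" "germ_in (conj_by b a) C"
      using cons(1,2) box by blast+
    then have "germ_in (conj_by x y) C" "germ_in (conj_by y x) C"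
      using coset'[OF rcoset_conj[OF An ab(1) x ab(2) y cosets]]
        coset'[OF rcoset_conj[OF An ab(2) y ab(1) x cosets(2,1)]] ab x y by simp_all
    with C show ?thesis by blast
  qed
  have self: "\<exists>C\<in>\<C>. germ_in x C" if x: "x \<in> carrier G" for x
    using pair[OF x x] x by (simp add: m_assoc)
  have bad_conj: "bad (conj_by x g)" if "bad x" and xg: "x \<in> carrier G" "g \<in> carrier G" for x g
  proof -
    have "{k \<in> carrier G. conj_by k g \<in> {\<one>}} \<subseteq> {\<one>}"
    proof
      fix k assume "k \<in> {k \<in> carrier G. conj_by k g \<in> {\<one>}}"
      then have k: "k \<in> carrier G" "conj_by k g = \<one>" by auto
      have "k = g \<otimes> conj_by k g \<otimes> inv g"
        using k(1) xg(2) by (simp add: m_assoc)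
      then show "k \<in> {\<one>}" using xg(2) by (simp add: k(2))
    qed
    then show ?thesis
      using germ_in_mono[of x "{k \<in> carrier G. conj_by k g \<in> {\<one>}}" "{\<one>}"] that(1)
      unfolding bad_def germ_in_conj[OF xg] by blast
  qed
  have share: "germ_equiv x y"
    if "C \<in> \<C>" "x \<in> carrier G" "y \<in> carrier G" "germ_in x C" "germ_in y C" "bad x" "bad y" for C x y
    unfolding germ_equiv_def
    using cover_nontrivial_germ[OF that(1) _ _ that(2,3,4)] cover_nontrivial_germ[OF that(1) _ _ that(3,2,5)]
      that by (auto simp: bad_def)
  have swap: "germ_equiv (conj_by x y) (conj_by y x)"
    if xy: "x \<in> carrier G" "y \<in> carrier G" and bad: "bad x" "bad y" for x y
  proof -
    obtain C where "C \<in> \<C>" "germ_in (conj_by x y) C" "germ_in (conj_by y x) C"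
      using pair[OF xy] by blast
    then show ?thesis
      using share[of C "conj_by x y" "conj_by y x"] bad_conj xy bad by simp
  qed
  have all_equiv: "germ_equiv x y"
    if x: "x \<in> carrier G" and y: "y \<in> carrier G" and bad: "bad x" "bad y" for x y
  proof (rule ccontr)
    assume not_equiv: "\<not> germ_equiv x y"
    have xy: "x \<otimes> y \<in> carrier G" "y \<otimes> x \<in> carrier G" "conj_by x y \<in> carrier G" "conj_by y x \<in> carrier G"
      using x y by simp_all
    have not_equiv': "\<not> germ_equiv (conj_by x y) y"
    proof
      assume "germ_equiv (conj_by x y) y"
      from germ_equiv_conj[OF this xy(3) y, of "inv y"] y
      have "germ_equiv (conj_by (conj_by x y) (inv y)) (conj_by y (inv y))" by simp
      moreover have "conj_by (conj_by x y) (inv y) = x" "conj_by y (inv y) = y"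
        using x y by (simp_all add: m_assoc)
      ultimately show False
        using not_equiv by (simp only:)
    qed
    have "bad (x \<otimes> y)"
    proof (rule ccontr)
      assume "\<not> bad (x \<otimes> y)"
      then have triv: "germ_in (x \<otimes> y) {\<one>}" by (simp add: bad_def)
      have "germ_in (conj_by x y) K = germ_in y K" if K: "subgroup K G" for K
        using germ_in_mono[OF triv one_mem[OF K]] germ_in_mult(2,3)[OF K x y] by blast
      then show False
        using not_equiv' by (simp add: germ_equiv_def)
    qed
    then have "bad (conj_by (x \<otimes> y) x)"
      using bad_conj xy(1) x by blast
    moreover have "conj_by (x \<otimes> y) x = y \<otimes> x"
      using x y by (simp add: m_assoc)
    ultimately have bad_yx: "bad (y \<otimes> x)" by (simp only:)
    have "germ_equiv (conj_by y (y \<otimes> x)) (conj_by (y \<otimes> x) y)"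
      by (rule swap[OF y xy(2) bad(2) bad_yx])
    moreover have "conj_by y (y \<otimes> x) = conj_by y x" "conj_by (y \<otimes> x) y = x \<otimes> y"
      using x y by (simp_all add: word_simps)
    ultimately have equiv: "germ_equiv (conj_by y x) (x \<otimes> y)" by (simp only:)
    obtain C where C: "C \<in> \<C>" "germ_in (x \<otimes> y) C"
      using self[OF xy(1)] by blast
    have "germ_in (conj_by y x) C"
      using equiv C cover_subgroup cover_closed by (simp add: germ_equiv_def)
    then have "germ_in (conj_by x y) C"
      using swap[OF x y bad] C(1) cover_subgroup cover_closed by (simp add: germ_equiv_def)
    moreover from this have "germ_in y C"
      using germ_in_mult(3)[OF cover_subgroup[OF C(1)] x y C(2)] by blast
    ultimately have "germ_equiv (conj_by x y) y"
      using share[OF C(1) xy(3) y] bad_conj[OF bad(1) x y] bad(2) by blast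
    with not_equiv' show False by contradiction
  qed
  have "\<exists>C\<in>\<C>. \<forall>x\<in>carrier G. germ_in x C"
  proof (cases "\<exists>x\<in>carrier G. bad x")
    case True
    then obtain x where x: "x \<in> carrier G" "bad x" by blast
    obtain C where C: "C \<in> \<C>" "germ_in x C"
      using self[OF x(1)] by blast
    have "germ_in y C" if y: "y \<in> carrier G" for y
    proof (cases "bad y")
      case True
      from all_equiv[OF x(1) y x(2) True] show ?thesis
        using C cover_subgroup[OF C(1)] cover_closed[OF C(1)] by (simp add: germ_equiv_def)
    next
      case False
      then have "germ_in y {\<one>}" by (simp add: bad_def)
      then show ?thesis
        by (rule germ_in_mono[OF _ one_mem[OF cover_subgroup[OF C(1)]]])
    qed
    with C show ?thesis by blast
  next
    case False
    obtain C where C: "C \<in> \<C>"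
      using self[OF one_closed] by blast
    have "germ_in y C" if y: "y \<in> carrier G" for y
    proof -
      have "germ_in y {\<one>}" using False y by (simp add: bad_def)
      then show ?thesis
        by (rule germ_in_mono[OF _ one_mem[OF cover_subgroup[OF C]]])
    qed
    with C show ?thesis by blast
  qed
  then obtain C where C: "C \<in> \<C>" "\<And>x. x \<in> carrier G \<Longrightarrow> germ_in x C" by blast
  have "commutator G h n \<in> C" if "h \<in> A" "n \<in> A" for h n
    using abelian[OF that] subgroup.one_closed[OF cover_subgroup[OF C(1)]] by simp
  from uniform_germ[OF cover_subgroup[OF C(1)] A this] show ?thesis
    using C by blast
qed

theorem uniform_germ_exists:
  "\<exists>C\<in>\<C>. \<exists>N. open_normal N \<and> (\<forall>g\<in>carrier G. \<forall>n\<in>N. commutator G g n \<in> C)"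
proof (cases "\<exists>A. open_normal A \<and> (\<forall>a\<in>A. \<forall>b\<in>A. commutator G a b = \<one>)")
  case True
  then show ?thesis using uniform_germ_abelian by blast
next
  case False
  then show ?thesis using uniform_germ_nonabelian by blast
qed

end

section \<open>Procyclic pro-p groups are uniserial\<close>

text \<open>Ideals \<open>(i, p\<^sup>n)\<close> of the integers are generated by powers of \<open>p\<close>, so they form a chain.\<close>

lemma primepow_ideals_chain:
  fixes i j :: int
  assumes "prime (p::nat)"
  shows "(\<exists>s t. i = s * j + t * int (p ^ n)) \<or> (\<exists>s t. j = s * i + t * int (p ^ n))"
proof -
  define q where "q = int (p ^ n)"
  have comb: "\<exists>s t. a = s * b + t * q" if dvd: "gcd b q dvd gcd a q" for a b
  proof -
    obtain u v where uv: "u * b + v * q = gcd b q"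
      using bezout_int by blast
    obtain c where "a = gcd b q * c"
      using dvd by (meson dvd_def dvd_trans gcd_dvd1)
    then have "a = (c * u) * b + (c * v) * q"
      unfolding uv[symmetric] by (simp add: algebra_simps)
    then show ?thesis by blast
  qed
  have pow: "\<exists>k. gcd a q = int p ^ k" for a
  proof -
    have "nat (gcd a q) dvd p ^ n"
      unfolding q_def using gcd_dvd2[of a "int (p ^ n)"]
      by (metis gcd_ge_0_int int_dvd_int_iff nat_0_le)
    then obtain k where "nat (gcd a q) = p ^ k"
      using divides_primepow_nat[OF assms] by blast
    then show ?thesis
      by (metis gcd_ge_0_int nat_0_le of_nat_power)
  qed
  obtain k l where "gcd i q = int p ^ k" "gcd j q = int p ^ l"
    using pow by meson
  then have "gcd j q dvd gcd i q \<or> gcd i q dvd gcd j q"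
    using le_imp_power_dvd[of k l "int p"] le_imp_power_dvd[of l k "int p"] nat_le_linear[of k l] by auto
  then show ?thesis
    unfolding q_def[symmetric] using comb by blast
qed

context profinite_group
begin

lemma open_normal_coset_meets:
  assumes V: "open_normal V" and x: "x \<in> T closure_of S"
  shows "\<exists>y\<in>S. V #> y = V #> x"
proof -
  have xc: "x \<in> carrier G"
    using x by (simp add: in_closure_of topspace_eq_carrier)
  have sub: "subgroup V G" using V by (rule open_normal_subgroup)
  have "openin T (V #> x)"
    using openin_rcoset[OF _ xc] V by (simp add: open_normal_def)
  moreover have "x \<in> V #> x"
    by (rule rcos_self[OF xc sub])
  ultimately obtain y where "y \<in> S" "y \<in> V #> x"
    using x unfolding in_closure_of by meson
  then show ?thesis
    using repr_independence[OF _ xc sub] by metis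
qed

text \<open>Let \<open>h \<noteq> \<one>\<close> be an element of \<open>P\<close> and \<open>U\<close> an open normal subgroup that omits \<open>h\<close>. Modulo an
  open normal subgroup \<open>V \<subseteq> U\<close> the group \<open>C\<close> is a cyclic \<open>p\<close>-group, so its subgroups form a
  chain. Since \<open>h\<close> lies outside \<open>U\<close>, the subgroup that it generates contains \<open>U \<inter> C\<close> modulo \<open>V\<close>.
  As \<open>V\<close> is arbitrary and \<open>P\<close> is closed, it follows that \<open>U \<inter> C \<subseteq> P\<close>.\<close>

lemma procyclic_pro_p_uniserial:
  assumes p: "prime (p::nat)"
    and g: "g \<in> carrier G" and C: "C \<subseteq> topologically_generated G T {g}"
    and ppow: "\<And>V. open_normal V \<Longrightarrow> \<exists>n. g [^] (p ^ n) \<in> V"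
    and P: "subgroup P G" "closedin T P" "P \<subseteq> C" "P \<noteq> {\<one>}"
  shows "\<exists>U. openin T U \<and> \<one> \<in> U \<and> U \<inter> C \<subseteq> P"
proof -
  obtain h where h: "h \<in> P" "h \<noteq> \<one>"
    using P(4) subgroup.one_closed[OF P(1)] by auto
  have hc: "h \<in> carrier G" using h(1) subgroup.mem_carrier[OF P(1)] by blast
  have "openin T (topspace T - {h})"
    using openin_diff[OF openin_topspace closedin_Hausdorff_singleton[OF Hausdorff]] hc
    by (simp add: topspace_eq_carrier)
  then obtain U where U: "open_normal U" "h \<notin> U"
    using open_normal_neighbourhood[of "topspace T - {h}"] h(2) by (auto simp: topspace_eq_carrier)
  have "u \<in> P" if uU: "u \<in> U" and uC: "u \<in> C" for u
  proof (rule ccontr)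
    assume uP: "u \<notin> P"
    have uc: "u \<in> carrier G" using open_normal_memD[OF U(1) uU] .
    define W where "W = {v \<in> topspace T. v \<otimes> u \<in> topspace T - P} \<inter> U"
    have "continuous_map T T (\<lambda>v. v \<otimes> u)"
      using uc by (intro continuous_map_mult) (simp_all add: topspace_eq_carrier)
    then have "openin T {v \<in> topspace T. v \<otimes> u \<in> topspace T - P}"
      by (rule openin_continuous_map_preimage) (simp add: P(2) openin_diff)
    then have "openin T W"
      using U(1) by (simp add: W_def open_normal_def openin_Int)
    moreover have "\<one> \<in> W"
      using uP uc subgroup.one_closed[OF open_normal_subgroup[OF U(1)]] by (simp add: W_def topspace_eq_carrier)
    ultimately obtain V where V: "open_normal V" "V \<subseteq> W"
      using open_normal_neighbourhood by meson
    interpret V: normal V G using V(1) by (simp add: open_normal_def)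
    interpret U: normal U G using U(1) by (simp add: open_normal_def)
    obtain n where n: "g [^] (p ^ n) \<in> V"
      using ppow[OF V(1)] by blast
    define q where "q = int (p ^ n)"
    have q: "g [^] q \<in> V"
      using n by (simp only: q_def int_pow_int)
    have power: "\<exists>i::int. V #> (g [^] i) = V #> x" if x: "x \<in> C" for x
    proof -
      have "x \<in> T closure_of (generate G {g})"
        using subsetD[OF C x] by (simp add: topologically_generated_def)
      then obtain y where "y \<in> generate G {g}" "V #> y = V #> x"
        using open_normal_coset_meets[OF V(1)] by meson
      then show ?thesis
        using generate_pow[OF g] by auto
    qed
    obtain i :: int where i: "V #> (g [^] i) = V #> u"
      using power[OF uC] by (elim exE)
    obtain j :: int where j: "V #> (g [^] j) = V #> h"
      using power[OF subsetD[OF P(3) h(1)]] by (elim exE)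
    have VU: "x \<in> U \<longleftrightarrow> y \<in> U" if eq: "V #> x = V #> y" and xy: "x \<in> carrier G" "y \<in> carrier G" for x y
    proof -
      have "x \<in> V #> y"
        using rcos_self[OF xy(1) V.subgroup_axioms] eq by simp
      then obtain v where v: "v \<in> V" "x = v \<otimes> y" by (auto simp: r_coset_def)
      have "v \<in> U" using v(1) V(2) by (auto simp: W_def)
      moreover have "y = inv v \<otimes> x"
        using v xy V.mem_carrier by simp
      ultimately show ?thesis
        using v(2) U.m_closed U.m_inv_closed by metis
    qed
    have iU: "g [^] i \<in> U" using VU[OF i] uU uc g by simp
    have jU: "g [^] j \<notin> U" using VU[OF j] U(2) hc g by simp
    have "g [^] q \<in> U" using q V(2) by (auto simp: W_def)
    have "\<not> (\<exists>s t. j = s * i + t * q)"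
    proof
      assume "\<exists>s t. j = s * i + t * q"
      then obtain s t where st: "j = s * i + t * q" by blast
      have "g [^] j = (g [^] i) [^] s \<otimes> (g [^] q) [^] t"
        using g by (simp add: st int_pow_mult int_pow_pow mult.commute)
      then have "g [^] j \<in> U"
        using iU \<open>g [^] q \<in> U\<close> subgroup_int_pow_closed[OF U.subgroup_axioms] U.m_closed by metis
      with jU show False by contradiction
    qed
    then obtain s t where "i = s * j + t * q"
      using primepow_ideals_chain[OF p, of i j n] unfolding q_def by blast
    then have st: "i = q * t + j * s" by simp
    have "(g [^] q) [^] t \<in> V"
      using q subgroup_int_pow_closed[OF V.subgroup_axioms] by blast
    have "V #> u = V #> (g [^] i)" by (simp add: i)
    also have "g [^] i = (g [^] q) [^] t \<otimes> (g [^] j) [^] s"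
      using g by (simp add: st int_pow_mult int_pow_pow)
    also have "V #> \<dots> = V #> ((g [^] j) [^] s)"
      using \<open>(g [^] q) [^] t \<in> V\<close> g V.subset
      by (simp add: coset_mult_assoc[symmetric] V.rcos_const)
    also have "\<dots> = (V #> (g [^] j)) [^]\<^bsub>G Mod V\<^esub> s"
      using V.FactGroup_int_pow[of "g [^] j" s] g by simp
    also have "\<dots> = V #> (h [^] s)"
      using V.FactGroup_int_pow[of h s] hc by (simp add: j)
    finally have "h [^] s \<in> V #> u"
      using rcos_self[OF int_pow_closed[OF hc] V.subgroup_axioms] by simp
    then obtain v where "v \<in> V" "h [^] s = v \<otimes> u" by (auto simp: r_coset_def)
    moreover have "h [^] s \<in> P"
      using h(1) subgroup_int_pow_closed[OF P(1)] by blast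
    ultimately show False
      using V(2) by (auto simp: W_def)
  qed
  then show ?thesis
    using U(1) subgroup.one_closed[OF open_normal_subgroup[OF U(1)]]
    by (intro exI[of _ U]) (auto simp: open_normal_def)
qed

section \<open>From a uniform germ to an open subgroup\<close>

text \<open>The elements \<open>[g, n]\<close> generate a normal subgroup \<open>E \<subseteq> C\<close>, and the image of \<open>N\<close> in the
  quotient by \<open>E\<close> is central of finite index. Schur's theorem applies to this quotient.\<close>

lemma finite_cosets_of_uniform_germ:
  assumes C: "subgroup C G" and N: "open_normal N"
    and NC: "\<And>g n. g \<in> carrier G \<Longrightarrow> n \<in> N \<Longrightarrow> commutator G g n \<in> C"
  shows "\<exists>X. finite X \<and> X \<subseteq> generate G (commutators G) \<and>
    generate G (commutators G) \<subseteq> (\<Union>x\<in>X. C #> x)"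
proof -
  define S where "S = {commutator G g n | g n. g \<in> carrier G \<and> n \<in> N}"
  define E where "E = generate G S"
  note Nc = open_normal_memD[OF N]
  have S: "S \<subseteq> carrier G" using Nc by (auto simp: S_def)
  have "g \<otimes> s \<otimes> inv g \<in> S" if s: "s \<in> S" and g: "g \<in> carrier G" for s g
  proof -
    obtain a n where an: "a \<in> carrier G" "n \<in> N" "s = commutator G a n"
      using s by (auto simp: S_def)
    have "g \<otimes> s \<otimes> inv g = commutator G (g \<otimes> a \<otimes> inv g) (g \<otimes> n \<otimes> inv g)"
      using conj_commutator[of a n "inv g"] an g Nc by simp
    moreover have "g \<otimes> n \<otimes> inv g \<in> N"
      using open_normal_conj'[OF N an(2) g] .
    ultimately show ?thesis
      unfolding S_def using an(1) g by blast
  qed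
  then have En: "E \<lhd> G"
    unfolding E_def by (intro normal_generateI S)
  interpret E: normal E G by (rule En)
  have EC: "E \<subseteq> C"
    unfolding E_def using NC by (intro generate_subgroup_incl C) (auto simp: S_def)
  let ?Q = "G Mod E"
  interpret Q: group ?Q by (rule E.factorgroup_is_group)
  interpret h: group_hom G ?Q "\<lambda>a. E #> a"
    by unfold_locales (rule E.r_coset_hom_Mod)
  have hcomm: "commutator ?Q (E #> x) (E #> y) = E #> commutator G x y"
    if "x \<in> carrier G" "y \<in> carrier G" for x y
  proof -
    have "E #> commutator G x y = inv\<^bsub>?Q\<^esub> (E #> x) \<otimes>\<^bsub>?Q\<^esub> inv\<^bsub>?Q\<^esub> (E #> y) \<otimes>\<^bsub>?Q\<^esub> (E #> x) \<otimes>\<^bsub>?Q\<^esub> (E #> y)"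
      unfolding commutator_def using that by (simp only: h.hom_mult h.hom_inv m_closed inv_closed)
    then show ?thesis by (simp only: commutator_def)
  qed
  have Qcarrier: "\<exists>x\<in>carrier G. a = E #> x" if "a \<in> carrier ?Q" for a
    using that by (auto simp: FactGroup_def RCOSETS_def)
  have central: "(E #> n) \<otimes>\<^bsub>?Q\<^esub> a = a \<otimes>\<^bsub>?Q\<^esub> (E #> n)" if n: "n \<in> N" and a: "a \<in> carrier ?Q" for n a
  proof -
    obtain g where g: "g \<in> carrier G" "a = E #> g"
      using Qcarrier[OF a] by blast
    have "commutator G g n \<in> E"
      unfolding E_def by (rule generate.incl) (use g n in \<open>auto simp: S_def\<close>)
    then have e: "inv (commutator G g n) \<in> E" by simp
    have nc: "n \<in> carrier G" using Nc n by simp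
    have "n \<otimes> g = g \<otimes> n \<otimes> inv (commutator G g n)"
      using g nc by (simp add: commutator_def word_simps)
    then have "E #> (n \<otimes> g) = (E #> (g \<otimes> n)) \<otimes>\<^bsub>?Q\<^esub> (E #> inv (commutator G g n))"
      using g nc by (simp only: h.hom_mult m_closed inv_closed commutator_closed)
    also have "E #> inv (commutator G g n) = \<one>\<^bsub>?Q\<^esub>"
      using E.rcos_const[OF is_group e] by (simp add: FactGroup_def)
    finally have "E #> (n \<otimes> g) = E #> (g \<otimes> n)"
      using g nc h.hom_closed[of "g \<otimes> n"] by (simp only: Q.r_one m_closed)
    then show ?thesis
      using g nc by (simp only: h.hom_mult)
  qed
  define k where "k = card (rcosets N)"
  have finN: "finite (rcosets N)" by (rule finite_rcosets_open_normal[OF N])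
  have k: "k > 0"
    unfolding k_def using finN subgroup.subgroup_in_rcosets[OF open_normal_subgroup[OF N] is_group]
    by (auto simp: card_gt_0_iff)
  have central_pow: "a [^]\<^bsub>?Q\<^esub> k \<otimes>\<^bsub>?Q\<^esub> b = b \<otimes>\<^bsub>?Q\<^esub> a [^]\<^bsub>?Q\<^esub> k"
    if a: "a \<in> carrier ?Q" and b: "b \<in> carrier ?Q" for a b
  proof -
    obtain g where g: "g \<in> carrier G" "a = E #> g"
      using Qcarrier[OF a] by blast
    have "g [^] k \<in> N"
      unfolding k_def using N g by (intro pow_card_rcosets_mem) (simp_all add: open_normal_def)
    moreover have "a [^]\<^bsub>?Q\<^esub> k = E #> (g [^] k)"
      using h.hom_nat_pow[OF g(1), of k] g(2) by simp
    ultimately show ?thesis using central b by simp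
  qed
  have "\<exists>x. x \<in> carrier G \<and> N #> x = c" if "c \<in> rcosets N" for c
    using that by (auto simp: RCOSETS_def)
  then obtain r where r: "\<And>c. c \<in> rcosets N \<Longrightarrow> r c \<in> carrier G \<and> N #> r c = c"
    by metis
  have rep: "\<exists>n\<in>N. \<exists>c\<in>rcosets N. x = n \<otimes> r c" if x: "x \<in> carrier G" for x
  proof -
    have c: "N #> x \<in> rcosets N"
      using x N by (simp add: rcosetsI open_normal_subgroup subgroup.subset)
    then have "x \<in> N #> r (N #> x)"
      using r rcos_self[OF x open_normal_subgroup[OF N]] by simp
    with c show ?thesis by (auto simp: r_coset_def)
  qed
  have comm_image: "commutators ?Q = (\<lambda>a. E #> a) ` commutators G"
  proof
    show "commutators ?Q \<subseteq> (\<lambda>a. E #> a) ` commutators G"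
    proof
      fix a assume "a \<in> commutators ?Q"
      then obtain u v where "u \<in> carrier ?Q" "v \<in> carrier ?Q" "a = commutator ?Q u v"
        by (auto simp: commutators_def)
      then obtain x y where "x \<in> carrier G" "y \<in> carrier G" "a = E #> commutator G x y"
        using Qcarrier hcomm by metis
      then show "a \<in> (\<lambda>a. E #> a) ` commutators G"
        by (auto simp: commutators_def)
    qed
    show "(\<lambda>a. E #> a) ` commutators G \<subseteq> commutators ?Q"
    proof
      fix a assume "a \<in> (\<lambda>a. E #> a) ` commutators G"
      then obtain x y where "x \<in> carrier G" "y \<in> carrier G" "a = E #> commutator G x y"
        by (auto simp: commutators_def)
      then have "a = commutator ?Q (E #> x) (E #> y)" "E #> x \<in> carrier ?Q" "E #> y \<in> carrier ?Q"
        using hcomm h.hom_closed by simp_all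
      then show "a \<in> commutators ?Q"
        unfolding commutators_def by blast
    qed
  qed
  have "commutators ?Q \<subseteq> (\<lambda>(c, d). commutator ?Q (E #> r c) (E #> r d)) ` ((rcosets N) \<times> (rcosets N))"
  proof
    fix a assume "a \<in> commutators ?Q"
    then obtain x y where xy: "x \<in> carrier G" "y \<in> carrier G" and a: "a = E #> commutator G x y"
      unfolding comm_image by (auto simp: commutators_def)
    obtain n c m d where n: "n \<in> N" and c: "c \<in> rcosets N" and x: "x = n \<otimes> r c"
      and m: "m \<in> N" and d: "d \<in> rcosets N" and y: "y = m \<otimes> r d"
      using rep xy by meson
    have cl: "E #> z \<in> carrier ?Q" if "z \<in> carrier G" for z
      using that by (rule h.hom_closed)
    have "a = commutator ?Q (E #> x) (E #> y)"
      using a hcomm xy by simp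
    also have "E #> x = (E #> n) \<otimes>\<^bsub>?Q\<^esub> (E #> r c)"
      using x Nc n r c by (simp only: h.hom_mult)
    also have "E #> y = (E #> m) \<otimes>\<^bsub>?Q\<^esub> (E #> r d)"
      using y Nc m r d by (simp only: h.hom_mult)
    also have "commutator ?Q ((E #> n) \<otimes>\<^bsub>?Q\<^esub> (E #> r c)) ((E #> m) \<otimes>\<^bsub>?Q\<^esub> (E #> r d))
        = commutator ?Q (E #> r c) ((E #> m) \<otimes>\<^bsub>?Q\<^esub> (E #> r d))"
      using cl Nc n m r c d by (intro Q.commutator_central_left central Q.m_closed) auto
    also have "\<dots> = commutator ?Q (E #> r c) (E #> r d)"
      using cl Nc m r c d by (intro Q.commutator_central_right central) auto
    finally show "a \<in> (\<lambda>(c, d). commutator ?Q (E #> r c) (E #> r d)) ` ((rcosets N) \<times> (rcosets N))"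
      using c d by auto
  qed
  then have "finite (commutators ?Q)"
    using finN by (meson finite_SigmaI finite_surj)
  then have "finite (generate ?Q (commutators ?Q))"
    using k central_pow by (rule Q.schur_finite_generate_commutators)
  then have "finite ((\<lambda>a. E #> a) ` generate G (commutators G))"
    using h.generate_img[OF commutators_subset] by (simp add: comm_image)
  then obtain X where X: "X \<subseteq> generate G (commutators G)" "finite X"
    "(\<lambda>a. E #> a) ` generate G (commutators G) = (\<lambda>a. E #> a) ` X"
    using finite_subset_image[of "(\<lambda>a. E #> a) ` generate G (commutators G)"] by (metis subset_refl)
  have "generate G (commutators G) \<subseteq> (\<Union>x\<in>X. C #> x)"
  proof
    fix d assume d: "d \<in> generate G (commutators G)"
    then have dc: "d \<in> carrier G"
      using generate_in_carrier[OF commutators_subset] by blast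
    obtain x where x: "x \<in> X" "E #> d = E #> x"
      using X(3) d by (metis imageE imageI)
    then have "d \<in> E #> x"
      using rcos_self[OF dc E.subgroup_axioms] by simp
    then have "d \<in> C #> x"
      using EC by (auto simp: r_coset_def)
    with x(1) show "d \<in> (\<Union>x\<in>X. C #> x)" by blast
  qed
  with X show ?thesis by blast
qed

text \<open>The complement of \<open>C\<close> in \<open>D\<close> is covered by the finitely many closed cosets other than \<open>C\<close>.\<close>

lemma openin_of_finite_cosets:
  assumes C: "subgroup C G" "closedin T C" and CD: "C \<subseteq> D" and D: "subgroup D G"
    and X: "finite X" "X \<subseteq> carrier G" "D \<subseteq> (\<Union>x\<in>X. C #> x)"
  shows "openin (subtopology T D) C"
proof -
  define K where "K = (\<Union>x\<in>X - C. C #> x)"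
  have K: "closedin T K"
    unfolding K_def using X C(2) by (intro closedin_Union) (auto intro: closedin_rcoset)
  have "C \<inter> K = {}"
  proof -
    have False if x: "x \<in> X - C" and c: "c \<in> C" "c \<in> C #> x" for c x
    proof -
      obtain c' where c': "c' \<in> C" "c = c' \<otimes> x"
        using c(2) by (auto simp: r_coset_def)
      then have "x = inv c' \<otimes> c"
        using x X(2) subgroup.mem_carrier[OF C(1)] by auto
      moreover have "inv c' \<otimes> c \<in> C"
        using c'(1) c(1) C(1) by (simp add: subgroup.m_closed subgroup.m_inv_closed)
      ultimately show False
        using x by simp
    qed
    then show ?thesis unfolding K_def by blast
  qed
  moreover have "D \<subseteq> C \<union> K"
  proof
    fix d assume "d \<in> D"
    then obtain x where x: "x \<in> X" "d \<in> C #> x" using X(3) by blast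
    show "d \<in> C \<union> K"
    proof (cases "x \<in> C")
      case True
      then show ?thesis
        using x(2) C(1) by (auto simp: r_coset_def subgroup.m_closed)
    qed (use x in \<open>auto simp: K_def\<close>)
  qed
  moreover have "D \<subseteq> topspace T"
    using subgroup.subset[OF D] by (simp add: topspace_eq_carrier)
  ultimately have "C = (topspace T - K) \<inter> D"
    using CD by blast
  then show ?thesis
    using K unfolding openin_subtopology by blast
qed

lemma procyclic_cover_open_member:
  fixes p :: nat and \<C> :: "'a set set"
  defines "D \<equiv> commutator_subgroup G T"
  assumes "prime p"
    and "pro_p_group (G\<lparr>carrier := D\<rparr>) (subtopology T D) p"
    and "countable \<C>"
    and "\<And>C. C \<in> \<C> \<Longrightarrow> procyclic_subgroup C (G\<lparr>carrier := D\<rparr>) (subtopology T D)"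
    and "commutators G \<subseteq> \<Union>\<C>"
  shows "\<exists>C\<in>\<C>. openin (subtopology T D) C"
proof -
  define GD where "GD = G\<lparr>carrier := D\<rparr>"
  interpret D: pro_p_group GD "subtopology T D" p
    using assms(3) by (simp add: GD_def)
  have D_def': "D = T closure_of (generate G (commutators G))"
    unfolding D_def commutator_subgroup_def topologically_generated_def ..
  have D_closed: "closedin T D"
    by (simp add: D_def')
  have D_carrier: "D \<subseteq> carrier G"
    using closedin_carrier[OF D_closed] .
  have D: "subgroup D G"
    using D.is_group D_carrier unfolding GD_def by (intro group_incl_imp_subgroup)
  have C_sub: "subgroup C G" and C_closed: "closedin T C" and C_D: "C \<subseteq> D"
    and C_gen: "\<exists>g\<in>D. C \<subseteq> topologically_generated G T {g}" if C: "C \<in> \<C>" for C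
  proof -
    have C': "subgroup C GD" "closedin (subtopology T D) C"
      "procyclic_group (GD\<lparr>carrier := C\<rparr>) (subtopology (subtopology T D) C)"
      using assms(5)[OF C] by (simp_all add: procyclic_subgroup_def GD_def)
    show CD: "C \<subseteq> D"
      using subgroup.subset[OF C'(1)] by (simp add: GD_def)
    show CG: "subgroup C G"
      using incl_subgroup[OF D] C'(1) by (simp add: GD_def)
    show "closedin T C"
      using closedin_trans_full[OF C'(2) D_closed] .
    obtain g where g: "g \<in> C" and
      gen: "topologically_generated (GD\<lparr>carrier := C\<rparr>) (subtopology (subtopology T D) C) {g} = C"
      using C'(3) by (auto simp: procyclic_group_def)
    have "generate (GD\<lparr>carrier := C\<rparr>) {g} = generate G {g}"
      using generate_consistent[of "{g}" C] CG g by (simp add: GD_def)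
    then have "C \<subseteq> topologically_generated G T {g}"
      using gen closure_of_subtopology_subset[of "subtopology T D" C "generate G {g}"]
        closure_of_subtopology_subset[of T D "generate G {g}"]
      unfolding topologically_generated_def by simp
    then show "\<exists>g\<in>D. C \<subseteq> topologically_generated G T {g}"
      using g CD by blast
  qed
  have ppow: "\<exists>n. g [^] (p ^ n) \<in> V" if g: "g \<in> D" and V: "open_normal V" for g V
  proof -
    have V': "V \<lhd> G" "openin T V" using V by (simp_all add: open_normal_def)
    have "D \<inter> V \<lhd> GD"
      unfolding GD_def using normal_Int_subgroup[OF D V'(1)] by (simp add: Int_commute)
    moreover have "openin (subtopology T D) (D \<inter> V)"
      using V'(2) by (auto simp: openin_subtopology)
    ultimately obtain n where n: "card (rcosets\<^bsub>GD\<^esub> (D \<inter> V)) = p ^ n"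
      using D.open_normal_index by blast
    have "g [^]\<^bsub>GD\<^esub> (p ^ n) \<in> D \<inter> V"
      using D.pow_card_rcosets_mem[OF \<open>D \<inter> V \<lhd> GD\<close>, of g] g n by (simp add: GD_def)
    then show ?thesis
      by (auto simp: GD_def simp flip: nat_pow_consistent)
  qed
  interpret commutator_cover G T \<C>
  proof (intro commutator_cover.intro commutator_cover_axioms.intro)
    show "profinite_group G T" by (rule profinite_group_axioms)
    show "countable \<C>" "commutators G \<subseteq> \<Union>\<C>" by (fact assms)+
    show "subgroup C G" "closedin T C" if "C \<in> \<C>" for C
      by (fact C_sub[OF that], fact C_closed[OF that])
    fix C P assume C: "C \<in> \<C>" and P: "subgroup P G" "closedin T P" "P \<subseteq> C" "P \<noteq> {\<one>}"
    obtain g where g: "g \<in> D" "C \<subseteq> topologically_generated G T {g}"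
      using C_gen[OF C] by blast
    have gc: "g \<in> carrier G" using g D_carrier by blast
    show "\<exists>W. openin T W \<and> \<one> \<in> W \<and> W \<inter> C \<subseteq> P"
      by (rule procyclic_pro_p_uniserial[OF assms(2) gc g(2) ppow[OF g(1)] P])
  qed
  obtain C N where C: "C \<in> \<C>" and N: "open_normal N"
    and NC: "\<And>g n. g \<in> carrier G \<Longrightarrow> n \<in> N \<Longrightarrow> commutator G g n \<in> C"
    using uniform_germ_exists by blast
  obtain X where X: "finite X" "X \<subseteq> generate G (commutators G)"
    "generate G (commutators G) \<subseteq> (\<Union>x\<in>X. C #> x)"
    using finite_cosets_of_uniform_germ[OF C_sub[OF C] N NC] by blast
  have Xc: "X \<subseteq> carrier G"
    using X(2) generate_in_carrier[OF commutators_subset] by blast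
  have "closedin T (\<Union>x\<in>X. C #> x)"
    using X(1) Xc C_closed[OF C] by (intro closedin_Union) (auto intro: closedin_rcoset)
  then have "D \<subseteq> (\<Union>x\<in>X. C #> x)"
    unfolding D_def' by (rule closure_of_minimal[OF X(3)])
  then have "openin (subtopology T D) C"
    by (rule openin_of_finite_cosets[OF C_sub[OF C] C_closed[OF C] C_D[OF C] D X(1) Xc])
  with C show ?thesis by blast
qed

end

theorem mainTheorem4:
  fixes G :: "('a, 'b) monoid_scheme" and T :: "'a topology"
    and p :: nat and \<C> :: "'a set set"
  defines "D \<equiv> commutator_subgroup G T"
  assumes "prime p"
    and "profinite_group G T"
    and "pro_p_group (G\<lparr>carrier := D\<rparr>) (subtopology T D) p"
    and "countable \<C>"
    and "\<And>C. C \<in> \<C> \<Longrightarrow> procyclic_subgroup C (G\<lparr>carrier := D\<rparr>) (subtopology T D)"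
    and "commutators G \<subseteq> \<Union>\<C>"
  shows "\<exists>C\<in>\<C>. openin (subtopology T D) C"
  using profinite_group.procyclic_cover_open_member[OF assms(3,2)] assms(4-7)
  unfolding D_def by blast

end
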